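(* Let $G$ be a discrete countable group and let $\mu$ be an admissible probability measure on $G$ with finite first moment. Let $(X,d)$ be a separable complete $\mathrm{CAT}(0)$ space and let $G\curvearrowright (X,d)$ be an action by isometries such that $G$ contains two independent contracting elements. Let $o\in X$ be a basepoint. Then for almost every $\omega\in\Omega$ there exists a geodesic ray $\gamma^\omega:[0,\infty)\to X$ issued from $o$ such that $$\lim_{n\to\infty}\frac1n d\big(\gamma^\omega(l_X(\mu)n),Z_n(\omega)o\big)=0,$$ where $l_X(\mu)>0$ is the drift of the random walk.
   Context: $\mu$ is admissible if its support generates $G$ as a semigroup. $\mu$ has finite first moment if $\int_G d(go,o)\,d\mu(g)<\infty$. Let $\Omega=G^{\mathbb N}$, $\mathbb P=\mu^{\otimes\mathbb N}$; for $\omega=(\omega_i)\in\Omega$ the random walk generated by $\mu$ is $Z_n(\omega)=\omega_1\omega_2\cdots\omega_n$, $Z_0=\mathrm{id}$. "Almost every" refers to $\mathbb P$. The drift is $l_X(\mu)=\lim_{n\to\infty}\frac1n\int_\Omega d(Z_n(\omega)o,o)\,d\mathbb P(\omega)$. An isometry $g$ of $X$ is axial if its displacement function $x\mapsto d(gx,x)$ attains a positive minimum; equivalently $g$ translates nontrivially along some geodesic line (an axis). A geodesic $\gamma$ is $C$-contracting ($C>0$) if for every metric ball $B$ disjoint from $\gamma$, the nearest-point projection $\pi_\gamma(B)$ has diameter at most $C$. An axial isometry is contracting if one of its axes is $C$-contracting for some $C>0$. Two axial isometries $g_1,g_2$ are independent if the map $(m,n)\in\mathbb Z\times\mathbb Z\mapsto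 d(g_1^m o,g_2^n o)\in[0,\infty)$ is proper; for contracting isometries this amounts to their pairs of fixed points in the visual boundary $\partial_\infty X$ being disjoint. *)

theory Defs
  imports "HOL-Probability.Probability" "HOL-Algebra.Group_Action"
begin

section \<open>Geodesics and CAT(0) spaces\<close>

text \<open>A geodesic parametrized by arc length: segments, rays and lines are obtained for
  \<open>I = {0..a}\<close>, \<open>I = {0..}\<close> and \<open>I = UNIV\<close>.\<close>

definition geodesic_on :: "real set \<Rightarrow> (real \<Rightarrow> 'x::metric_space) \<Rightarrow> bool" where
  "geodesic_on I c \<longleftrightarrow> (\<forall>s\<in>I. \<forall>t\<in>I. dist (c s) (c t) = \<bar>s - t\<bar>)"

definition geodesic_from_to :: "'x::metric_space \<Rightarrow> 'x \<Rightarrow> (real \<Rightarrow> 'x) \<Rightarrow> bool" where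
  "geodesic_from_to p q c \<longleftrightarrow>
     geodesic_on {0..dist p q} c \<and> c 0 = p \<and> c (dist p q) = q"

definition geodesic_space :: "'x::metric_space itself \<Rightarrow> bool" where
  "geodesic_space _ \<longleftrightarrow> (\<forall>p q::'x. \<exists>c. geodesic_from_to p q c)"

text \<open>A geodesic space is CAT(0) if the distance between two points of a geodesic triangle
  \<open>p\<close>, \<open>q\<close>, \<open>r\<close> is at most that of their comparison points in a Euclidean comparison triangle
  \<open>p'\<close>, \<open>q'\<close>, \<open>r'\<close>. Any two sides share a vertex, called \<open>p\<close> here, and the case of two points on
  one side is trivial, so it is enough to compare points on the sides from \<open>p\<close> to \<open>q\<close> and from
  \<open>p\<close> to \<open>r\<close>.\<close>

definition CAT0 :: "'x::metric_space itself \<Rightarrow> bool" where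
  "CAT0 _ \<longleftrightarrow> geodesic_space TYPE('x) \<and>
     (\<forall>(p::'x) q r c1 c2. geodesic_from_to p q c1 \<longrightarrow> geodesic_from_to p r c2 \<longrightarrow>
       (\<forall>(p'::real^2) q' r'.
          dist p' q' = dist p q \<longrightarrow> dist p' r' = dist p r \<longrightarrow> dist q' r' = dist q r \<longrightarrow>
          (\<forall>s\<in>{0..dist p q}. \<forall>t\<in>{0..dist p r}.
             \<forall>x'\<in>closed_segment p' q'. \<forall>y'\<in>closed_segment p' r'.
               dist p' x' = s \<longrightarrow> dist p' y' = t \<longrightarrow> dist (c1 s) (c2 t) \<le> dist x' y')))"


section \<open>Contracting isometries\<close>

definition axial :: "('x::metric_space \<Rightarrow> 'x) \<Rightarrow> bool" where
  "axial f \<longleftrightarrow> (\<exists>x. 0 < dist (f x) x \<and> (\<forall>y. dist (f x) x \<le> dist (f y) y))"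

definition axis_of :: "('x::metric_space \<Rightarrow> 'x) \<Rightarrow> (real \<Rightarrow> 'x) \<Rightarrow> bool" where
  "axis_of f c \<longleftrightarrow> geodesic_on UNIV c \<and> (\<exists>a. a \<noteq> 0 \<and> (\<forall>t. f (c t) = c (t + a)))"

definition nearest_points :: "'x::metric_space set \<Rightarrow> 'x set \<Rightarrow> 'x set" where
  "nearest_points Y B = {p\<in>Y. \<exists>x\<in>B. \<forall>q\<in>Y. dist x p \<le> dist x q}"

text \<open>Here \<open>Y\<close> is the image of the geodesic. The diameter bound is written out because
  \<^const>\<open>diameter\<close> is a meaningful supremum only on bounded sets.\<close>

definition contracting_set :: "real \<Rightarrow> 'x::metric_space set \<Rightarrow> bool" where
  "contracting_set C Y \<longleftrightarrow>
     (\<forall>x r. ball x r \<inter> Y = {} \<longrightarrow>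
        (\<forall>p\<in>nearest_points Y (ball x r). \<forall>q\<in>nearest_points Y (ball x r). dist p q \<le> C))"

definition contracting_isometry :: "('x::metric_space \<Rightarrow> 'x) \<Rightarrow> bool" where
  "contracting_isometry f \<longleftrightarrow>
     axial f \<and> (\<exists>c. axis_of f c \<and> (\<exists>C>0. contracting_set C (range c)))"

definition independent_elements ::
  "('g, 'm) monoid_scheme \<Rightarrow> ('g \<Rightarrow> 'x \<Rightarrow> 'x::metric_space) \<Rightarrow> 'x \<Rightarrow> 'g \<Rightarrow> 'g \<Rightarrow> bool" where
  "independent_elements G \<phi> x0 g h \<longleftrightarrow>
     proper_map (discrete_topology UNIV) (top_of_set {0..})
       (\<lambda>(m::int, n::int). dist (\<phi> (g [^]\<^bsub>G\<^esub> m) x0) (\<phi> (h [^]\<^bsub>G\<^esub> n) x0))"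


section \<open>Random walks\<close>

inductive_set generated_semigroup :: "('g, 'm) monoid_scheme \<Rightarrow> 'g set \<Rightarrow> 'g set"
  for G and S where
  incl: "g \<in> S \<Longrightarrow> g \<in> generated_semigroup G S"
| mult: "g \<in> generated_semigroup G S \<Longrightarrow> h \<in> generated_semigroup G S
         \<Longrightarrow> g \<otimes>\<^bsub>G\<^esub> h \<in> generated_semigroup G S"

definition discrete_prob_on :: "('g, 'm) monoid_scheme \<Rightarrow> 'g measure \<Rightarrow> bool" where
  "discrete_prob_on G \<mu> \<longleftrightarrow> prob_space \<mu> \<and> sets \<mu> = Pow (carrier G)"

definition admissible :: "('g, 'm) monoid_scheme \<Rightarrow> 'g measure \<Rightarrow> bool" where
  "admissible G \<mu> \<longleftrightarrow> generated_semigroup G {g \<in> carrier G. 0 < measure \<mu> {g}} = carrier G"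

definition finite_first_moment ::
  "('g \<Rightarrow> 'x \<Rightarrow> 'x::metric_space) \<Rightarrow> 'x \<Rightarrow> 'g measure \<Rightarrow> bool" where
  "finite_first_moment \<phi> x0 \<mu> \<longleftrightarrow> (\<integral>\<^sup>+ g. ennreal (dist (\<phi> g x0) x0) \<partial>\<mu>) < \<infinity>"

definition increments :: "'g measure \<Rightarrow> (nat \<Rightarrow> 'g) measure" where
  "increments \<mu> = (\<Pi>\<^sub>M i\<in>UNIV. \<mu>)"

text \<open>The increments are indexed from \<open>0\<close>: the \<open>i\<close>-th increment is \<open>\<omega> (i - 1)\<close>.\<close>

primrec walk :: "('g, 'm) monoid_scheme \<Rightarrow> (nat \<Rightarrow> 'g) \<Rightarrow> nat \<Rightarrow> 'g" where
  "walk G \<omega> 0 = \<one>\<^bsub>G\<^esub>"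
| "walk G \<omega> (Suc n) = walk G \<omega> n \<otimes>\<^bsub>G\<^esub> \<omega> n"

definition mean_speed ::
  "('g, 'm) monoid_scheme \<Rightarrow> ('g \<Rightarrow> 'x \<Rightarrow> 'x::metric_space) \<Rightarrow> 'x \<Rightarrow> 'g measure \<Rightarrow> nat \<Rightarrow> real"
  where
  "mean_speed G \<phi> x0 \<mu> n = (1 / real n) * (\<integral>\<omega>. dist (\<phi> (walk G \<omega> n) x0) x0 \<partial>increments \<mu>)"

definition drift ::
  "('g, 'm) monoid_scheme \<Rightarrow> ('g \<Rightarrow> 'x \<Rightarrow> 'x::metric_space) \<Rightarrow> 'x \<Rightarrow> 'g measure \<Rightarrow> real" where
  "drift G \<phi> x0 \<mu> = lim (mean_speed G \<phi> x0 \<mu>)"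

end

theory Submission
  imports Defs
begin

text \<open>
  Positivity of the drift. Let \<open>D n x\<close> be the mean of \<open>d(x, Z_n o)\<close>. If there are finitely many group
  elements \<open>s_1, \<dots>, s_m\<close> such that the average of \<open>d(s_i x, y)\<close> is at least \<open>d(o, y) + 1/m\<close> for all
  points \<open>x\<close> and \<open>y\<close>, then the infimum of \<open>D n\<close> over \<^emph>\<open>all\<close> base points grows linearly in \<open>n\<close>; no pivotal
  times and no boundary are needed. High powers of two independent contracting isometries and
  their inverses are such elements: the distance between points with distant projections to a
  contracting axis is the length of the detour through the axis up to a constant, and no point
  projects far from \<open>o\<close> on both axes.

  Tracking (Karlsson--Margulis). Riesz's lemma on leaders, applied to the subadditive cocycle
  \<open>d(o, Z_n o) - (l - \<epsilon>) n\<close> and combined with Kolmogorov's zero-one law, gives for almost every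
  trajectory infinitely many \<open>n\<close> such that \<open>d(Z_k o, Z_n o) \<le> d(o, Z_n o) - (l - \<epsilon>) k\<close> for all \<open>k\<close> from a
  fixed rank up to \<open>n\<close>. By the CAT(0) inequality \<open>Z_k o\<close> is then within \<open>O(\<surd>\<epsilon>) k\<close> of the geodesic from
  \<open>o\<close> to \<open>Z_n o\<close>, and for \<open>\<epsilon>\<close> tending to \<open>0\<close> fast enough these geodesics converge to the ray.
\<close>

section \<open>CAT(0) geometry\<close>

text \<open>The infimum runs over all base points because conditioning on the first increment moves
  \<open>x\<close> to its image under the inverse of that increment, a point over which there is no
  control; a bound uniform in the base point survives this. The averaged inequality has
  \<open>d(o, y)\<close> and not \<open>d(x, y)\<close> on its right side: averaged over
  \<open>y = Z_n o\<close> it gives \<open>D n o\<close>, which is at least the infimum, so the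
  infimum gains a fixed amount over each stretch in which the \<open>s_i\<close> can occur. Tracking
  also needs the almost sure bound \<open>d(o, Z_k o) \<le> (l + \<epsilon>) k\<close>. It comes
  from the leader argument too, applied to sums of block deficits, so neither Birkhoff's nor
  Kingman's theorem is invoked. That argument only yields an event of positive probability; by the
  zero-one law almost every trajectory enters it after some shift, and the finite initial piece is
  absorbed by enlarging \<epsilon>.\<close>

lemma comparison_triangle_exists:
  fixes a b c :: real
  assumes "0 \<le> a" "0 \<le> b" "0 \<le> c" "a \<le> b + c" "b \<le> a + c" "c \<le> a + b"
  obtains p q r :: "real^2" where "dist p q = a" "dist p r = b" "dist q r = c"
proof (cases "a = 0")
  case True
  have "dist (0::real^2) (vector [b, 0]) = b"
    using assms by (simp add: dist_norm norm_vec_def L2_set_def UNIV_2)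
  then show ?thesis using that[of 0 0 "vector [b, 0]"] assms True by auto
next
  case False
  then have a: "0 < a" using assms by simp
  \<comment> \<open>Law of cosines: \<open>u\<close> is the signed projection of the third vertex on
    the side of length \<open>a\<close>. The triangle inequalities give
    \<open>\<bar>u\<bar> \<le> b\<close>, so the root defining \<open>v\<close> is real.\<close>
  define u where "u = (a\<^sup>2 + b\<^sup>2 - c\<^sup>2) / (2 * a)"
  define v where "v = sqrt (b\<^sup>2 - u\<^sup>2)"
  have ua: "2 * a * u = a\<^sup>2 + b\<^sup>2 - c\<^sup>2" unfolding u_def using a by simp
  have "c\<^sup>2 \<le> (a + b)\<^sup>2" "(a - b)\<^sup>2 \<le> c\<^sup>2"
    using assms by (auto intro!: power_mono simp: abs_le_square_iff[symmetric])
  then have "\<bar>2 * a * u\<bar> \<le> 2 * a * b"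
    unfolding ua by (simp add: power2_sum power2_diff abs_le_iff)
  then have "\<bar>u\<bar> \<le> \<bar>b\<bar>" using a assms by (simp add: abs_mult)
  then have v2: "v\<^sup>2 = b\<^sup>2 - u\<^sup>2"
    unfolding v_def by (simp add: abs_le_square_iff)
  define q where "q = (vector [a, 0] :: real^2)"
  define r where "r = (vector [u, v] :: real^2)"
  have "dist 0 q = a"
    using a by (simp add: q_def dist_norm norm_vec_def L2_set_def UNIV_2)
  moreover have "dist 0 r = b"
    using v2 assms by (simp add: r_def dist_norm norm_vec_def L2_set_def UNIV_2)
  moreover have "dist q r = c"
  proof -
    have "(a - u)\<^sup>2 + v\<^sup>2 = c\<^sup>2"
      unfolding v2 using ua by (simp add: power2_eq_square algebra_simps)
    then show ?thesis
      using assms by (simp add: q_def r_def dist_norm norm_vec_def L2_set_def UNIV_2)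
  qed
  ultimately show ?thesis using that by blast
qed

lemma geodesic_fromD:
  assumes "geodesic_from_to p q c"
  shows "c 0 = p" "c (dist p q) = q"
    "\<And>s t. \<lbrakk>0 \<le> s; s \<le> dist p q; 0 \<le> t; t \<le> dist p q\<rbrakk> \<Longrightarrow> dist (c s) (c t) = \<bar>s - t\<bar>"
    "\<And>s. \<lbrakk>0 \<le> s; s \<le> dist p q\<rbrakk> \<Longrightarrow> dist p (c s) = s"
    "\<And>s. \<lbrakk>0 \<le> s; s \<le> dist p q\<rbrakk> \<Longrightarrow> dist (c s) q = dist p q - s"
proof -
  show 0: "c 0 = p" and 1: "c (dist p q) = q" using assms by (auto simp: geodesic_from_to_def)
  show *: "dist (c s) (c t) = \<bar>s - t\<bar>"
    if "0 \<le> s" "s \<le> dist p q" "0 \<le> t" "t \<le> dist p q" for s t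
    using that assms by (auto simp: geodesic_from_to_def geodesic_on_def)
  show "dist p (c s) = s" if "0 \<le> s" "s \<le> dist p q" for s
    using *[of 0 s] that 0 by auto
  show "dist (c s) q = dist p q - s" if "0 \<le> s" "s \<le> dist p q" for s
    using *[of s "dist p q"] that 1 by auto
qed

lemma CAT0_geodesic:
  assumes "CAT0 TYPE('x::metric_space)"
  obtains c where "geodesic_from_to (p::'x) q c"
  using assms unfolding CAT0_def geodesic_space_def by blast

text \<open>Points are given by fractions of the sides, so that comparison points are affine
  expressions and one Euclidean triangle serves all \<open>l\<close> and \<open>m\<close>. Later
  inequalities become inner product computations in the plane.\<close>

lemma CAT0_comparison:
  fixes p q r :: "'x::metric_space"
  assumes "CAT0 TYPE('x)" "geodesic_from_to p q c1" "geodesic_from_to p r c2"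
  shows "\<exists>p' q' r' :: real^2.
    dist p' q' = dist p q \<and> dist p' r' = dist p r \<and> dist q' r' = dist q r \<and>
    (\<forall>l\<in>{0..1}. \<forall>m\<in>{0..1}. dist (c1 (l * dist p q)) (c2 (m * dist p r))
       \<le> dist (p' + l *\<^sub>R (q' - p')) (p' + m *\<^sub>R (r' - p')))"
proof -
  obtain p' q' r' :: "real^2" where d:
    "dist p' q' = dist p q" "dist p' r' = dist p r" "dist q' r' = dist q r"
    by (rule comparison_triangle_exists[of "dist p q" "dist p r" "dist q r"])
      (auto simp: dist_commute dist_triangle dist_triangle2 dist_triangle3)
  have seg: "p' + l *\<^sub>R (y - p') \<in> closed_segment p' y" if "0 \<le> l" "l \<le> 1" for l and y :: "real^2"
    using that by (auto simp: closed_segment_def algebra_simps intro!: exI[of _ l])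
  have dst: "dist p' (p' + l *\<^sub>R (y - p')) = l * dist p' y" if "0 \<le> l" for l and y :: "real^2"
    using that by (simp add: dist_norm norm_minus_commute)
  have "dist (c1 (l * dist p q)) (c2 (m * dist p r))
       \<le> dist (p' + l *\<^sub>R (q' - p')) (p' + m *\<^sub>R (r' - p'))"
    if "l \<in> {0..1}" "m \<in> {0..1}" for l m
  proof -
    have l: "0 \<le> l" "l \<le> 1" and m: "0 \<le> m" "m \<le> 1" using that by auto
    have 1: "l * dist p q \<in> {0..dist p q}" "m * dist p r \<in> {0..dist p r}"
      using l m by (auto simp: mult_left_le_one_le)
    have 2: "dist p' (p' + l *\<^sub>R (q' - p')) = l * dist p q"
      "dist p' (p' + m *\<^sub>R (r' - p')) = m * dist p r"
      using dst l m d by auto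
    from assms(1) have "\<forall>s\<in>{0..dist p q}. \<forall>t\<in>{0..dist p r}.
        \<forall>x'\<in>closed_segment p' q'. \<forall>y'\<in>closed_segment p' r'.
          dist p' x' = s \<longrightarrow> dist p' y' = t \<longrightarrow> dist (c1 s) (c2 t) \<le> dist x' y'"
      unfolding CAT0_def using assms(2,3) d by blast
    with 1 2 seg[OF l] seg[OF m] show ?thesis by blast
  qed
  with d show ?thesis by blast
qed

text \<open>Stewart's theorem is an identity in the plane; comparing with the far end
  \<open>z\<close> of the other side turns it into an inequality. The case \<open>l = 1/2\<close> is
  the Bruhat-Tits inequality.\<close>

lemma CAT0_stewart:
  fixes p q z :: "'x::metric_space"
  assumes X: "CAT0 TYPE('x)" and c: "geodesic_from_to p q c" and l: "0 \<le> l" "l \<le> 1"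
  shows "(dist z (c (l * dist p q)))\<^sup>2
    \<le> (1 - l) * (dist z p)\<^sup>2 + l * (dist z q)\<^sup>2 - l * (1 - l) * (dist p q)\<^sup>2"
proof -
  obtain c2 where c2: "geodesic_from_to p z c2" using CAT0_geodesic[OF X] .
  obtain p' q' z' :: "real^2" where d: "dist p' q' = dist p q" "dist p' z' = dist p z" "dist q' z' = dist q z"
    and cmp: "\<forall>l\<in>{0..1}. \<forall>m\<in>{0..1}. dist (c (l * dist p q)) (c2 (m * dist p z))
       \<le> dist (p' + l *\<^sub>R (q' - p')) (p' + m *\<^sub>R (z' - p'))"
    using CAT0_comparison[OF X c c2] by blast
  have "dist z (c (l * dist p q)) \<le> dist (p' + l *\<^sub>R (q' - p')) z'"
    using cmp[rule_format, of l 1] l geodesic_fromD(2)[OF c2] by (simp add: dist_commute)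
  then have "(dist z (c (l * dist p q)))\<^sup>2 \<le> (dist (p' + l *\<^sub>R (q' - p')) z')\<^sup>2"
    by (simp add: power_mono)
  also have "\<dots> = (1 - l) * (dist p' z')\<^sup>2 + l * (dist q' z')\<^sup>2 - l * (1 - l) * (dist p' q')\<^sup>2"
    unfolding dist_norm power2_norm_eq_inner
    by (simp add: inner_simps inner_commute power2_eq_square algebra_simps)
  finally show ?thesis by (simp add: d dist_commute)
qed

text \<open>Both sides are cut at the common length \<open>R\<close>; in the comparison triangle the
  points at fraction \<open>s / R\<close> are then related by a homothety to the third side.\<close>

lemma CAT0_convex:
  fixes p :: "'x::metric_space"
  assumes X: "CAT0 TYPE('x)" and "geodesic_from_to p q c1" "geodesic_from_to p r c2"
    and R: "R \<le> dist p q" "R \<le> dist p r" and s: "0 \<le> s" "s \<le> R" "0 < R"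
  shows "dist (c1 s) (c2 s) \<le> s / R * dist (c1 R) (c2 R)"
proof -
  have pR: "dist p (c1 R) = R" "dist p (c2 R) = R"
    using geodesic_fromD(4)[OF assms(2), of R] geodesic_fromD(4)[OF assms(3), of R] R s by auto
  have 1: "geodesic_from_to p (c1 R) c1" "geodesic_from_to p (c2 R) c2"
    using assms(2,3) R s pR unfolding geodesic_from_to_def geodesic_on_def by auto
  obtain p' q' r' :: "real^2" where "dist q' r' = dist (c1 R) (c2 R)"
    "\<forall>l\<in>{0..1}. \<forall>m\<in>{0..1}. dist (c1 (l * R)) (c2 (m * R))
       \<le> dist (p' + l *\<^sub>R (q' - p')) (p' + m *\<^sub>R (r' - p'))"
    using CAT0_comparison[OF X 1] unfolding pR by blast
  from this(1) this(2)[rule_format, of "s/R" "s/R"]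
  have le: "dist (c1 s) (c2 s) \<le> dist (p' + (s/R) *\<^sub>R (q' - p')) (p' + (s/R) *\<^sub>R (r' - p'))"
    and e: "dist q' r' = dist (c1 R) (c2 R)" using s by auto
  have "dist (p' + (s/R) *\<^sub>R (q' - p')) (p' + (s/R) *\<^sub>R (r' - p')) = s/R * dist q' r'"
  proof -
    have "p' + (s/R) *\<^sub>R (q' - p') - (p' + (s/R) *\<^sub>R (r' - p')) = (s/R) *\<^sub>R (q' - r')"
      by (simp add: algebra_simps)
    then show ?thesis unfolding dist_norm using s by simp
  qed
  with le e show ?thesis by simp
qed

lemma CAT0_four_point:
  fixes x y p q :: "'x::metric_space"
  assumes X: "CAT0 TYPE('x)"
  shows "(dist x q)\<^sup>2 + (dist y p)\<^sup>2 \<le> (dist x y)\<^sup>2 + (dist y q)\<^sup>2 + (dist x p)\<^sup>2 + (dist p q)\<^sup>2"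
proof -
  obtain c where c: "geodesic_from_to x q c" using CAT0_geodesic[OF X] .
  let ?m = "c (1/2 * dist x q)"
  have 1: "(dist y ?m)\<^sup>2 \<le> 1/2 * (dist y x)\<^sup>2 + 1/2 * (dist y q)\<^sup>2 - 1/4 * (dist x q)\<^sup>2"
    using CAT0_stewart[OF X c, of "1/2" y] by simp
  have 2: "(dist p ?m)\<^sup>2 \<le> 1/2 * (dist p x)\<^sup>2 + 1/2 * (dist p q)\<^sup>2 - 1/4 * (dist x q)\<^sup>2"
    using CAT0_stewart[OF X c, of "1/2" p] by simp
  have "dist y p \<le> dist y ?m + dist p ?m" by (rule dist_triangle2)
  then have "(dist y p)\<^sup>2 \<le> (dist y ?m + dist p ?m)\<^sup>2" by (simp add: power_mono)
  also have "\<dots> \<le> 2 * (dist y ?m)\<^sup>2 + 2 * (dist p ?m)\<^sup>2"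
    using sum_squares_bound[of "dist y ?m" "dist p ?m"] by (simp add: power2_sum)
  finally show ?thesis using 1 2 by (simp add: dist_commute)
qed

section \<open>Projection to a contracting line\<close>

locale contracting_line =
  fixes c :: "real \<Rightarrow> 'x::metric_space" and C :: real
  assumes X: "CAT0 TYPE('x)" and line: "geodesic_on UNIV c"
    and C_pos: "0 < C" and contracting: "contracting_set C (range c)"
begin

text \<open>The nearest point is stored as a parameter of the line, so that feet can be subtracted.
  Existence of a minimizer is shown inside \<open>height_le\<close>, uniqueness follows from
  \<open>foot_eqI\<close>.\<close>

definition foot :: "'x \<Rightarrow> real" where
  "foot x = (SOME t. \<forall>s. dist x (c t) \<le> dist x (c s))"

definition height :: "'x \<Rightarrow> real" where
  "height x = dist x (c (foot x))"

text \<open>In \<open>bottleneck\<close>, \<open>2 * C\<close> pays for one use of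
  \<open>foot_near\<close> at each end, and 2 for stopping a distance 1 short of each
  height.\<close>

definition K :: real where "K = 2 * C + 2"

lemma K_pos: "0 < K"
  using C_pos by (simp add: K_def)

lemma dist_line: "dist (c s) (c t) = \<bar>s - t\<bar>"
  using line by (simp add: geodesic_on_def)

lemma height_nonneg: "0 \<le> height x"
  by (simp add: height_def)

lemma height_le: "height x \<le> dist x (c s)"
proof -
  \<comment> \<open>Parameters beyond \<open>?R\<close> give points farther from \<open>x\<close>
    than \<open>c 0\<close>, so a minimum over this compact interval is global.\<close>
  let ?R = "2 * dist x (c 0)"
  have cont: "continuous_on {-?R..?R} (\<lambda>s. dist x (c s))"
  proof (rule lipschitz_on_continuous_on)
    show "1-lipschitz_on {-?R..?R} (\<lambda>s. dist x (c s))"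
      by (rule lipschitz_onI, simp_all)
        (metis abs_dist_diff_le dist_commute dist_line dist_real_def)
  qed
  have "\<exists>t\<in>{-?R..?R}. \<forall>s\<in>{-?R..?R}. dist x (c t) \<le> dist x (c s)"
    by (rule continuous_attains_inf) (use cont in auto)
  then obtain t where t: "\<And>s. s \<in> {-?R..?R} \<Longrightarrow> dist x (c t) \<le> dist x (c s)" by blast
  have "dist x (c t) \<le> dist x (c s)" for s
  proof (cases "s \<in> {-?R..?R}")
    case False
    then have "?R < \<bar>s\<bar>" by auto
    moreover have "\<bar>s\<bar> \<le> dist x (c s) + dist x (c 0)"
      using dist_triangle3[of "c s" "c 0" x] dist_line[of s 0] by simp
    moreover have "dist x (c t) \<le> dist x (c 0)" by (rule t) simp
    ultimately show ?thesis by simp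
  qed (rule t)
  then have "\<forall>s. dist x (c (foot x)) \<le> dist x (c s)"
    unfolding foot_def by (rule someI[of _ t, OF allI])
  then show ?thesis by (simp add: height_def)
qed

text \<open>The angle at the foot is at least a right angle: in Stewart's inequality at fraction
  \<open>l\<close> of the way from the foot to \<open>c s\<close>, the left side is at least
  \<open>(height x)\<^sup>2\<close>; divide by \<open>l\<close> and let \<open>l\<close> tend to
  0.\<close>

lemma pythagoras: "(height x)\<^sup>2 + (s - foot x)\<^sup>2 \<le> (dist x (c s))\<^sup>2"
proof -
  define D where "D = dist (c (foot x)) (c s)"
  have D: "D = \<bar>foot x - s\<bar>" by (simp add: D_def dist_line)
  define g where "g r = c (foot x + sgn (s - foot x) * r)" for r
  have "geodesic_from_to (c (foot x)) (c s) g"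
    unfolding geodesic_from_to_def geodesic_on_def D_def[symmetric]
    by (auto simp: g_def dist_line D sgn_if abs_mult)
  from CAT0_stewart[OF X this]
  have st: "(dist x (g (l * D)))\<^sup>2 \<le> (1 - l) * (height x)\<^sup>2 + l * (dist x (c s))\<^sup>2 - l * (1 - l) * D\<^sup>2"
    if "0 \<le> l" "l \<le> 1" for l
    using that by (simp add: height_def D_def)
  have "D\<^sup>2 \<le> (dist x (c s))\<^sup>2 - (height x)\<^sup>2"
  \<comment> \<open>With \<open>z = 1 - l\<close> this rule plays the role of the limit as
    \<open>l\<close> tends to 0.\<close>
  proof (rule field_le_mult_one_interval)
    fix z :: real assume z: "0 < z" "z < 1"
    let ?l = "1 - z"
    have "(height x)\<^sup>2 \<le> (dist x (g (?l * D)))\<^sup>2"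
      unfolding g_def using height_le height_nonneg by (intro power_mono) auto
    with st[of ?l] z
    have "?l * (height x)\<^sup>2 \<le> ?l * ((dist x (c s))\<^sup>2 - z * D\<^sup>2)"
      by (simp add: algebra_simps)
    then have "(height x)\<^sup>2 \<le> (dist x (c s))\<^sup>2 - z * D\<^sup>2" using z by simp
    then show "z * D\<^sup>2 \<le> (dist x (c s))\<^sup>2 - (height x)\<^sup>2" by simp
  qed
  then show ?thesis by (simp add: D power2_commute)
qed

text \<open>In the quadrilateral of the two points and their feet, \<open>pythagoras\<close> bounds
  both diagonals from below; in \<open>CAT0_four_point\<close> the heights then cancel and one
  square of the foot difference remains.\<close>

lemma foot_lipschitz: "\<bar>foot x - foot y\<bar> \<le> dist x y"
proof -
  have "(dist x (c (foot y)))\<^sup>2 + (dist y (c (foot x)))\<^sup>2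
    \<le> (dist x y)\<^sup>2 + (height y)\<^sup>2 + (height x)\<^sup>2 + (foot x - foot y)\<^sup>2"
    using CAT0_four_point[OF X, of x "c (foot y)" y "c (foot x)"]
    by (simp add: height_def dist_line)
  with pythagoras[of x "foot y"] pythagoras[of y "foot x"]
  have "(foot x - foot y)\<^sup>2 \<le> (dist x y)\<^sup>2"
    by (simp add: power2_commute)
  then show ?thesis by (rule abs_le_square_iff[THEN iffD2, of _ "dist x y", simplified])
qed

lemma foot_eqI:
  assumes "\<And>s. dist x (c t) \<le> dist x (c s)"
  shows "foot x = t"
proof -
  have "(dist x (c t))\<^sup>2 \<le> (height x)\<^sup>2" unfolding height_def by (intro power_mono assms) simp
  with pythagoras[of x t] have "(t - foot x)\<^sup>2 \<le> 0" by linarith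
  then show ?thesis by simp
qed

lemma
  assumes iso: "\<And>y z. dist (f y) (f z) = dist y z" and tr: "\<And>s. f (c s) = c (s + a)"
  shows foot_translate: "foot (f x) = foot x + a"
    and height_translate: "height (f x) = height x"
proof -
  have *: "dist (f x) (c s) = dist x (c (s - a))" for s
    using iso[of x "c (s - a)"] tr[of "s - a"] by simp
  show "foot (f x) = foot x + a"
    by (rule foot_eqI) (simp add: * height_le[unfolded height_def])
  then show "height (f x) = height x" by (simp add: height_def *)
qed

lemma nearest_point:
  assumes "x \<in> B" shows "c (foot x) \<in> nearest_points (range c) B"
  using assms height_le[of x] by (auto simp: nearest_points_def height_def intro!: bexI[of _ x])

text \<open>The open ball about \<open>x\<close> of radius \<open>height x\<close> misses the line
  and contains both points, so the contraction property applies.\<close>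

lemma foot_near:
  assumes "dist x z < height x"
  shows "\<bar>foot x - foot z\<bar> \<le> C"
proof -
  have "ball x (height x) \<inter> range c = {}" using height_le[of x] by (auto simp: leD)
  moreover have "x \<in> ball x (height x)" "z \<in> ball x (height x)"
    using assms zero_le_dist[of x z] by (simp_all del: zero_le_dist)
  ultimately have "dist (c (foot x)) (c (foot z)) \<le> C"
    using contracting nearest_point unfolding contracting_set_def by blast
  then show ?thesis by (simp add: dist_line)
qed

text \<open>Along the geodesic from \<open>x\<close> to \<open>y\<close> the foot moves by at most
  \<open>C\<close> while within \<open>height x\<close> of \<open>x\<close>, by at most
  \<open>C\<close> while within \<open>height y\<close> of \<open>y\<close>, and in between by at
  most the length of the middle piece. A large displacement of the foot therefore forces a long
  middle piece.\<close>

lemma bottleneck: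
  "\<bar>foot x - foot y\<bar> \<le> K \<or> height x + height y + \<bar>foot x - foot y\<bar> - K \<le> dist x y"
proof -
  obtain g where g: "geodesic_from_to x y g" using CAT0_geodesic[OF X] .
  note gd = geodesic_fromD[OF g]
  have zx: "\<bar>foot x - foot y\<bar> \<le> C" if "height x = 0" "dist x y < height y"
  proof -
    have "dist y (c (foot x)) = dist y x" using that(1) by (simp add: height_def)
    with height_le[of y "foot x"] that(2) show ?thesis by (simp add: dist_commute)
  qed
  have zy: "\<bar>foot x - foot y\<bar> \<le> C" if "height y = 0" "dist x y < height x"
  proof -
    have "dist x (c (foot y)) = dist x y" using that(1) by (simp add: height_def)
    with height_le[of x "foot y"] that(2) show ?thesis by simp
  qed
  show ?thesis
  proof (cases "dist x y < height x + height y")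
    case True
    have "\<bar>foot x - foot y\<bar> \<le> 2 * C"
    proof (cases "height x = 0 \<or> height y = 0")
      case True
      then show ?thesis using zx zy C_pos \<open>dist x y < height x + height y\<close> by fastforce
    next
      case False
      then have h: "0 < height x" "0 < height y"
        using height_nonneg[of x] height_nonneg[of y] by auto
      \<comment> \<open>The open balls of radii \<open>height x\<close> and \<open>height y\<close>
        about the ends overlap along the geodesic; \<open>g r\<close> is chosen in both, so there is
        no middle piece.\<close>
      have "max 0 (dist x y - height y) < height x" using h True by auto
      then obtain t where t: "max 0 (dist x y - height y) < t" "t < height x" using dense by blast
      define r where "r = min (dist x y) t"
      have r: "0 \<le> r" "r \<le> dist x y" "r < height x" "dist x y - r < height y"
        using h t by (auto simp: r_def min_def)
      define z where "z = g r"
      have "dist x z < height x" "dist y z < height y"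
        using gd(4)[of r] gd(5)[of r] r unfolding z_def by (auto simp: dist_commute)
      with foot_near[of x z] foot_near[of y z] show ?thesis by linarith
    qed
    then show ?thesis by (simp add: K_def)
  next
    case False
    \<comment> \<open>Stopping 1 short of each height keeps \<open>g r1\<close> and
      \<open>g r2\<close> inside the open balls; truncation at 0 takes care of heights below
      1.\<close>
    define r1 where "r1 = max 0 (height x - 1)"
    define r2 where "r2 = dist x y - max 0 (height y - 1)"
    have r: "0 \<le> r1" "r1 \<le> r2" "r2 \<le> dist x y"
      using False height_nonneg[of x] height_nonneg[of y] zero_le_dist[of x y] unfolding r1_def r2_def by linarith+
    have "\<bar>foot x - foot (g r1)\<bar> \<le> C"
    proof (cases "height x = 0")
      case True
      then show ?thesis using gd(1) C_pos by (simp add: r1_def)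
    next
      case False
      then have "r1 < height x" using height_nonneg[of x] by (auto simp: r1_def)
      then show ?thesis using foot_near[of x "g r1"] gd(4)[of r1] r by simp
    qed
    moreover have "\<bar>foot y - foot (g r2)\<bar> \<le> C"
    proof (cases "height y = 0")
      case True
      then show ?thesis using gd(2) C_pos by (simp add: r2_def)
    next
      case False
      then have "dist x y - r2 < height y" using height_nonneg[of y] by (auto simp: r2_def)
      then show ?thesis using foot_near[of y "g r2"] gd(5)[of r2] r by (simp add: dist_commute)
    qed
    moreover have "\<bar>foot (g r1) - foot (g r2)\<bar> \<le> r2 - r1"
      using foot_lipschitz[of "g r1" "g r2"] gd(3)[of r1 r2] r by simp
    ultimately have "\<bar>foot x - foot y\<bar> \<le> r2 - r1 + 2 * C" by linarith
    then show ?thesis unfolding r1_def r2_def K_def by linarith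
  qed
qed

text \<open>By continuity some \<open>g r\<close> has foot \<open>s\<close>. Applying
  \<open>bottleneck\<close> to both halves counts \<open>height (g r)\<close> twice, while the path
  through the line bounds the total length; comparison leaves
  \<open>height (g r) \<le> K\<close>.\<close>

lemma passes_near:
  assumes g: "geodesic_from_to u x g" and s: "s \<in> closed_segment (foot u) (foot x)"
    and far: "K < \<bar>s - foot u\<bar>" "K < \<bar>s - foot x\<bar>"
  obtains r where "0 \<le> r" "r \<le> dist u x" "dist (g r) (c s) \<le> K"
    "\<bar>r - \<bar>s - foot u\<bar>\<bar> \<le> height u + K"
proof -
  note gd = geodesic_fromD[OF g]
  have "continuous_on {0..dist u x} (\<lambda>r. foot (g r))"
  proof (rule lipschitz_on_continuous_on)
    show "1-lipschitz_on {0..dist u x} (\<lambda>r. foot (g r))"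
    proof (rule lipschitz_onI)
      fix r r' assume "r \<in> {0..dist u x}" "r' \<in> {0..dist u x}"
      then show "dist (foot (g r)) (foot (g r')) \<le> 1 * dist r r'"
        using foot_lipschitz[of "g r" "g r'"] gd(3)[of r r'] by (simp add: dist_real_def)
    qed simp
  qed
  then have "connected ((\<lambda>r. foot (g r)) ` {0..dist u x})"
    by (intro connected_continuous_image) auto
  moreover have "foot u \<in> (\<lambda>r. foot (g r)) ` {0..dist u x}"
    using gd(1) by (intro image_eqI[of _ _ 0]) auto
  moreover have "foot x \<in> (\<lambda>r. foot (g r)) ` {0..dist u x}"
    using gd(2) by (intro image_eqI[of _ _ "dist u x"]) auto
  ultimately have "closed_segment (foot u) (foot x) \<subseteq> (\<lambda>r. foot (g r)) ` {0..dist u x}"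
    unfolding closed_segment_eq_real_ivl by (simp add: connected_contains_Icc)
  then have "s \<in> (\<lambda>r. foot (g r)) ` {0..dist u x}" using s by blast
  then obtain r where r: "0 \<le> r" "r \<le> dist u x" and s_eq: "foot (g r) = s"
    by (elim imageE) auto
  have d: "dist u (g r) = r" "dist (g r) x = dist u x - r" using gd(4,5) r by auto
  have tri: "dist u x \<le> height u + \<bar>foot u - foot x\<bar> + height x"
    using dist_triangle[of u x "c (foot u)"] dist_triangle[of "c (foot u)" x "c (foot x)"]
    by (simp add: height_def dist_line dist_commute)
  have tri2: "r \<le> height u + \<bar>foot u - s\<bar> + height (g r)"
    using dist_triangle[of u "g r" "c (foot u)"] dist_triangle[of "c (foot u)" "g r" "c s"] d s_eq
    by (simp add: height_def dist_line dist_commute)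
  have 1: "height u + height (g r) + \<bar>foot u - s\<bar> - K \<le> r"
    using bottleneck[of u "g r"] far(1) unfolding d s_eq by linarith
  have 2: "height (g r) + height x + \<bar>s - foot x\<bar> - K \<le> dist u x - r"
    using bottleneck[of "g r" x] far(2) unfolding d s_eq by linarith
  have 3: "\<bar>foot u - s\<bar> + \<bar>s - foot x\<bar> = \<bar>foot u - foot x\<bar>"
    using s by (cases "foot u \<le> foot x") (simp_all add: closed_segment_eq_real_ivl split: if_splits)
  have "height (g r) \<le> K" using 1 2 3 tri by linarith
  moreover have "\<bar>r - \<bar>s - foot u\<bar>\<bar> \<le> height u + K"
    using 1 tri2 \<open>height (g r) \<le> K\<close> height_nonneg[of u] height_nonneg[of "g r"] by linarith
  ultimately show ?thesis using that r s_eq by (auto simp: height_def)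
qed

lemma dist_le_heights: "dist x y \<le> height x + \<bar>foot x - foot y\<bar> + height y"
  using dist_triangle[of x y "c (foot x)"] dist_triangle[of "c (foot x)" y "c (foot y)"]
  by (simp add: height_def dist_line dist_commute)

text \<open>A one-sided form of \<open>bottleneck\<close> without exceptional case: for close feet
  it follows from the triangle inequality through the foot of \<open>x\<close>, at the cost of the
  sign of \<open>height x\<close>.\<close>

lemma dist_ge_heights: "height y + \<bar>foot x - foot y\<bar> - K - height x \<le> dist x y"
proof -
  have "height y \<le> dist y x + height x"
    using height_le[of y "foot x"] dist_triangle[of y "c (foot x)" x] unfolding height_def by linarith
  with bottleneck[of x y] height_nonneg[of x] show ?thesis by (auto simp: dist_commute)
qed

context
  fixes f f' :: "'x \<Rightarrow> 'x" and T :: real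
  assumes f: "\<And>y z. dist (f y) (f z) = dist y z" "\<And>s. f (c s) = c (s + T)"
    and f': "\<And>y z. dist (f' y) (f' z) = dist y z" "\<And>s. f' (c s) = c (s - T)"
begin

lemma translate_simps:
  "foot (f x) = foot x + T" "height (f x) = height x"
  "foot (f' x) = foot x - T" "height (f' x) = height x"
  using foot_translate[OF f] height_translate[OF f]
    foot_translate[of f' "- T"] height_translate[of f' "- T"] f' by auto

text \<open>At most one of \<open>f x\<close> and \<open>f' x\<close> has its foot near that of \<open>y\<close>; for the other the gain
  \<open>height x\<close> compensates the possible loss \<open>height x\<close>.\<close>
lemma translate_pair_ge:
  assumes "K < \<bar>T\<bar>"
  shows "2 * height y + 2 * max \<bar>foot x - foot y\<bar> \<bar>T\<bar> - 2 * K \<le> dist (f x) y + dist (f' x) y"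
proof -
  define e where "e = foot x - foot y"
  have e: "foot x + T - foot y = e + T" "foot x - T - foot y = e - T" by (simp_all add: e_def)
  have 1: "height y + \<bar>e + T\<bar> - K - height x \<le> dist (f x) y"
    using dist_ge_heights[of y "f x"] unfolding translate_simps e .
  have 2: "height y + \<bar>e - T\<bar> - K - height x \<le> dist (f' x) y"
    using dist_ge_heights[of y "f' x"] unfolding translate_simps e .
  have 3: "\<bar>e + T\<bar> \<le> K \<or> height x + height y + \<bar>e + T\<bar> - K \<le> dist (f x) y"
    using bottleneck[of "f x" y] unfolding translate_simps e .
  have 4: "\<bar>e - T\<bar> \<le> K \<or> height x + height y + \<bar>e - T\<bar> - K \<le> dist (f' x) y"
    using bottleneck[of "f' x" y] unfolding translate_simps e .
  define P where "P = \<bar>e + T\<bar>"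
  define Q where "Q = \<bar>e - T\<bar>"
  define m where "m = max \<bar>e\<bar> \<bar>T\<bar>"
  have 5: "P + Q = 2 * m" unfolding P_def Q_def m_def by (simp add: max_def abs_if)
  have "\<not> (P \<le> K \<and> Q \<le> K)" unfolding P_def Q_def using assms by linarith
  with 1 2 3 4 5 height_nonneg[of x] show ?thesis
    unfolding e_def[symmetric] P_def[symmetric] Q_def[symmetric] m_def[symmetric] by linarith
qed

text \<open>Here both translates have feet more than \<open>K\<close> away from that of
  \<open>y\<close>, so neither loses \<open>height x\<close>; compared with
  \<open>translate_pair_ge\<close> this gains \<open>2 * height x\<close>.\<close>

lemma translate_pair_ge':
  assumes "\<bar>foot x - foot y\<bar> + K < \<bar>T\<bar>"
  shows "2 * height x + 2 * height y + 2 * \<bar>T\<bar> - 2 * K \<le> dist (f x) y + dist (f' x) y"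
  using bottleneck[of "f x" y] bottleneck[of "f' x" y] assms K_pos unfolding translate_simps
  by linarith

end

end

section \<open>Two independent contracting lines\<close>

definition translates :: "('x::metric_space \<Rightarrow> 'x) \<Rightarrow> (real \<Rightarrow> 'x) \<Rightarrow> real \<Rightarrow> bool" where
  "translates f c a \<longleftrightarrow> (\<forall>y z. dist (f y) (f z) = dist y z) \<and> (\<forall>s. f (c s) = c (s + a))"

context contracting_line
begin

lemma passes_near_radius:
  assumes g: "geodesic_from_to u x g" and \<rho>: "K < \<rho>" "\<rho> < \<bar>foot x - foot u\<bar> - K"
  obtains \<sigma> r where "\<bar>\<sigma>\<bar> = \<rho>" "0 \<le> r" "r \<le> dist u x"
    "dist (g r) (c (foot u + \<sigma>)) \<le> K" "\<bar>r - \<rho>\<bar> \<le> height u + K"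
proof -
  define \<sigma> where "\<sigma> = (if foot u \<le> foot x then \<rho> else - \<rho>)"
  have s: "foot u + \<sigma> \<in> closed_segment (foot u) (foot x)"
    using \<rho> K_pos by (auto simp: \<sigma>_def closed_segment_eq_real_ivl)
  have "K < \<bar>foot u + \<sigma> - foot u\<bar>" "K < \<bar>foot u + \<sigma> - foot x\<bar>" "\<bar>\<sigma>\<bar> = \<rho>"
    using \<rho> K_pos by (auto simp: \<sigma>_def)
  with passes_near[OF g s] that show ?thesis by (metis add_diff_cancel_left')
qed

lemma dist_translate_le:
  assumes "translates f c a"
  shows "dist (f u) (c s) \<le> height u + \<bar>foot u + a - s\<bar>"
proof -
  have "dist (f u) (c s) \<le> dist (f u) (f (c (foot u))) + dist (f (c (foot u))) (c s)"
    by (rule dist_triangle)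
  moreover have "dist (f u) (f (c (foot u))) = height u" "f (c (foot u)) = c (foot u + a)"
    using assms unfolding translates_def height_def by blast+
  ultimately show ?thesis by (simp add: dist_line)
qed

end

lemma approximate_multiple:
  fixes a s :: real
  assumes "a \<noteq> 0" shows "\<exists>m::int. \<bar>of_int m * a - s\<bar> \<le> \<bar>a\<bar>"
proof -
  have "\<bar>of_int \<lfloor>s / a\<rfloor> - s / a\<bar> \<le> 1" by linarith
  then have "\<bar>of_int \<lfloor>s / a\<rfloor> - s / a\<bar> * \<bar>a\<bar> \<le> 1 * \<bar>a\<bar>" by (intro mult_right_mono) simp_all
  moreover have "\<bar>of_int \<lfloor>s / a\<rfloor> - s / a\<bar> * \<bar>a\<bar> = \<bar>of_int \<lfloor>s / a\<rfloor> * a - s\<bar>"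
    using assms unfolding abs_mult[symmetric] by (simp add: left_diff_distrib)
  ultimately show ?thesis by auto
qed

locale two_contracting_lines =
  L1: contracting_line c1 C1 + L2: contracting_line c2 C2
  for c1 c2 :: "real \<Rightarrow> 'x::metric_space" and C1 C2 :: real +
  fixes u :: 'x
begin

text \<open>One geodesic from \<open>u\<close> to \<open>x\<close> follows both lines, passing near
  each at arc length about \<rho>. The two points are thus close, with a bound that does not depend
  on \<rho>.\<close>

lemma common_points:
  assumes "L1.K < \<rho>" "\<rho> < \<bar>L1.foot x - L1.foot u\<bar> - L1.K"
    and "L2.K < \<rho>" "\<rho> < \<bar>L2.foot x - L2.foot u\<bar> - L2.K"
  obtains \<sigma>1 \<sigma>2 where "\<bar>\<sigma>1\<bar> = \<rho>" "\<bar>\<sigma>2\<bar> = \<rho>"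
    "dist (c1 (L1.foot u + \<sigma>1)) (c2 (L2.foot u + \<sigma>2))
      \<le> 2 * L1.K + 2 * L2.K + L1.height u + L2.height u"
proof -
  obtain g where g: "geodesic_from_to u x g" using CAT0_geodesic[OF L1.X] .
  obtain \<sigma>1 r1 where 1: "\<bar>\<sigma>1\<bar> = \<rho>" "0 \<le> r1" "r1 \<le> dist u x"
    "dist (g r1) (c1 (L1.foot u + \<sigma>1)) \<le> L1.K" "\<bar>r1 - \<rho>\<bar> \<le> L1.height u + L1.K"
    using L1.passes_near_radius[OF g assms(1,2)] .
  obtain \<sigma>2 r2 where 2: "\<bar>\<sigma>2\<bar> = \<rho>" "0 \<le> r2" "r2 \<le> dist u x"
    "dist (g r2) (c2 (L2.foot u + \<sigma>2)) \<le> L2.K" "\<bar>r2 - \<rho>\<bar> \<le> L2.height u + L2.K"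
    using L2.passes_near_radius[OF g assms(3,4)] .
  have "dist (g r1) (g r2) = \<bar>r1 - r2\<bar>" using geodesic_fromD(3)[OF g] 1 2 by simp
  moreover have "\<bar>r1 - r2\<bar> \<le> L1.height u + L1.K + (L2.height u + L2.K)"
    using 1(5) 2(5) by linarith
  moreover have "dist (c1 (L1.foot u + \<sigma>1)) (c2 (L2.foot u + \<sigma>2))
      \<le> dist (g r1) (c1 (L1.foot u + \<sigma>1)) + dist (g r1) (g r2) + dist (g r2) (c2 (L2.foot u + \<sigma>2))"
    by (smt (verit) dist_commute dist_triangle)
  ultimately show ?thesis using that[OF 1(1) 2(1)] 1(4) 2(4) by linarith
qed

text \<open>A point projecting far on both lines would give, by \<open>common_points\<close>, orbit
  points \<open>P m u\<close> and \<open>Q n u\<close> within a fixed distance \<open>r\<close>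
  although \<open>\<bar>m\<bar>\<close> is as large as desired; properness excludes this.\<close>

lemma bounded_projections:
  fixes P Q :: "int \<Rightarrow> 'x \<Rightarrow> 'x"
  assumes a: "a1 \<noteq> 0" "a2 \<noteq> 0"
    and P: "\<And>m. translates (P m) c1 (of_int m * a1)"
    and Q: "\<And>n. translates (Q n) c2 (of_int n * a2)"
    and fin: "\<And>r. finite {(m, n). dist (P m u) (Q n u) \<le> r}"
  shows "\<exists>R. \<forall>x. \<bar>L1.foot x - L1.foot u\<bar> \<le> R \<or> \<bar>L2.foot x - L2.foot u\<bar> \<le> R"
proof -
  define r where "r = 2 * L1.K + 2 * L2.K + 2 * L1.height u + 2 * L2.height u + \<bar>a1\<bar> + \<bar>a2\<bar>"
  have "finite (fst ` {(m, n). dist (P m u) (Q n u) \<le> r})" using fin by simp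
  then obtain M where M: "\<And>m n. dist (P m u) (Q n u) \<le> r \<Longrightarrow> \<bar>m\<bar> \<le> M"
    using bdd_above_finite[of "abs ` fst ` {(m, n). dist (P m u) (Q n u) \<le> r}"]
    unfolding bdd_above_def by fastforce
  \<comment> \<open>Any multiple of \<open>a1\<close> within \<open>\<bar>a1\<bar>\<close> of a
    number of absolute value \<rho> must have index beyond \<open>\<bar>M\<bar>\<close>. The bound
    \<open>M\<close> comes from \<open>r\<close>, which is independent of \<rho>, so the choice is
    not circular.\<close>
  define \<rho> where "\<rho> = (\<bar>M\<bar> + 1) * \<bar>a1\<bar> + L1.K + L2.K + 1"
  have \<rho>: "L1.K < \<rho>" "L2.K < \<rho>" 
  proof -
    have "0 \<le> (\<bar>M\<bar> + 1) * \<bar>a1\<bar>" by simp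
    then show "L1.K < \<rho>" "L2.K < \<rho>" using L1.K_pos L2.K_pos unfolding \<rho>_def by linarith+
  qed
  have "\<bar>L1.foot x - L1.foot u\<bar> \<le> \<rho> + L1.K + L2.K \<or> \<bar>L2.foot x - L2.foot u\<bar> \<le> \<rho> + L1.K + L2.K" for x
  proof (rule ccontr)
    assume "\<not> ?thesis"
    then have "\<rho> < \<bar>L1.foot x - L1.foot u\<bar> - L1.K" "\<rho> < \<bar>L2.foot x - L2.foot u\<bar> - L2.K"
      using L1.K_pos L2.K_pos by auto
    from common_points[OF \<rho>(1) this(1) \<rho>(2) this(2)] obtain \<sigma>1 \<sigma>2
      where \<sigma>: "\<bar>\<sigma>1\<bar> = \<rho>" "\<bar>\<sigma>2\<bar> = \<rho>" and d: "dist (c1 (L1.foot u + \<sigma>1)) (c2 (L2.foot u + \<sigma>2))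
      \<le> 2 * L1.K + 2 * L2.K + L1.height u + L2.height u" .
    obtain m where m: "\<bar>of_int m * a1 - \<sigma>1\<bar> \<le> \<bar>a1\<bar>" using approximate_multiple[OF a(1)] ..
    obtain n where n: "\<bar>of_int n * a2 - \<sigma>2\<bar> \<le> \<bar>a2\<bar>" using approximate_multiple[OF a(2)] ..
    have "dist (P m u) (c1 (L1.foot u + \<sigma>1)) \<le> L1.height u + \<bar>a1\<bar>"
      using L1.dist_translate_le[OF P, of m u "L1.foot u + \<sigma>1"] m by simp
    moreover have "dist (Q n u) (c2 (L2.foot u + \<sigma>2)) \<le> L2.height u + \<bar>a2\<bar>"
      using L2.dist_translate_le[OF Q, of n u "L2.foot u + \<sigma>2"] n by simp
    moreover have "dist (P m u) (Q n u) \<le> dist (P m u) (c1 (L1.foot u + \<sigma>1))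
      + dist (c1 (L1.foot u + \<sigma>1)) (c2 (L2.foot u + \<sigma>2)) + dist (Q n u) (c2 (L2.foot u + \<sigma>2))"
      by (smt (verit) dist_commute dist_triangle)
    ultimately have "dist (P m u) (Q n u) \<le> r" using d unfolding r_def by linarith
    then have "\<bar>m\<bar> \<le> \<bar>M\<bar>" using M by fastforce
    then have "\<bar>of_int m\<bar> * \<bar>a1\<bar> \<le> of_int \<bar>M\<bar> * \<bar>a1\<bar>"
      by (intro mult_right_mono) (simp_all flip: of_int_abs)
    moreover have "\<rho> \<le> \<bar>of_int m\<bar> * \<bar>a1\<bar> + \<bar>a1\<bar>"
      using m \<sigma>(1) unfolding abs_mult[symmetric] by linarith
    ultimately show False using L1.K_pos L2.K_pos by (simp add: \<rho>_def algebra_simps)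
  qed
  then show ?thesis by blast
qed

text \<open>If both \<open>x\<close> and \<open>y\<close> project near \<open>u\<close> on one of the lines, the two translates along that line gain
  \<open>2 dist u x + 2 \<bar>T\<bar>\<close>, while those along the other line lose at most \<open>2 dist u x\<close>. Otherwise neither
  pair loses and one of them gains \<open>2 \<bar>T\<bar>\<close>.\<close>
lemma four_translates:
  assumes R: "\<And>x. \<bar>L1.foot x - L1.foot u\<bar> \<le> R \<or> \<bar>L2.foot x - L2.foot u\<bar> \<le> R"
  obtains T0 where "\<And>T1 T2 f1 f1' f2 f2' x y. \<lbrakk>T0 \<le> \<bar>T1\<bar>; T0 \<le> \<bar>T2\<bar>;
      translates f1 c1 T1; translates f1' c1 (- T1); translates f2 c2 T2; translates f2' c2 (- T2)\<rbrakk>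
    \<Longrightarrow> 4 * dist u y + 1 \<le> dist (f1 x) y + dist (f1' x) y + dist (f2 x) y + dist (f2' x) y"
proof -
  define E where "E = L1.height u + L2.height u"
  define K where "K = L1.K + L2.K"
  have E: "0 \<le> L1.height u" "L1.height u \<le> E" "0 \<le> L2.height u" "L2.height u \<le> E"
    using L1.height_nonneg L2.height_nonneg by (auto simp: E_def)
  have K: "0 < L1.K" "L1.K \<le> K" "0 < L2.K" "L2.K \<le> K" using L1.K_pos L2.K_pos by (auto simp: K_def)
  have R0: "0 \<le> R" using R[of u] by auto
  \<comment> \<open>The bounded errors are heights of \<open>u\<close> (\<open>E\<close>), near
    projections (\<open>R\<close>) and detour constants (\<open>K\<close>); a gain of
    \<open>2 * T0\<close> covers their total in each of the four cases below.\<close>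
  define T0 where "T0 = 6 * E + 3 * R + 6 * K + 1"
  have "4 * dist u y + 1 \<le> dist (f1 x) y + dist (f1' x) y + dist (f2 x) y + dist (f2' x) y"
    if T: "T0 \<le> \<bar>T1\<bar>" "T0 \<le> \<bar>T2\<bar>" and
      f: "translates f1 c1 T1" "translates f1' c1 (- T1)"
        "translates f2 c2 T2" "translates f2' c2 (- T2)"
    for T1 T2 f1 f1' f2 f2' x y
  proof -
    note f' = f[unfolded translates_def, simplified]
    define a1 b1 a2 b2 where "a1 = L1.foot x - L1.foot u" and "b1 = L1.foot y - L1.foot u"
      and "a2 = L2.foot x - L2.foot u" and "b2 = L2.foot y - L2.foot u"
    have ab: "L1.foot x - L1.foot y = a1 - b1" "L2.foot x - L2.foot y = a2 - b2"
      by (auto simp: a1_def a2_def b1_def b2_def)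
    have T1: "L1.K < \<bar>T1\<bar>" "2 * R + K < \<bar>T1\<bar>" and T2: "L2.K < \<bar>T2\<bar>" "2 * R + K < \<bar>T2\<bar>"
      using T E K R0 unfolding T0_def by linarith+
    define p1 p2 where "p1 = dist (f1 x) y + dist (f1' x) y" and "p2 = dist (f2 x) y + dist (f2' x) y"
    have p1: "2 * L1.height y + 2 * max \<bar>a1 - b1\<bar> \<bar>T1\<bar> - 2 * L1.K \<le> p1"
      unfolding p1_def ab[symmetric] by (rule L1.translate_pair_ge) (use f' T1 in auto)
    have p2: "2 * L2.height y + 2 * max \<bar>a2 - b2\<bar> \<bar>T2\<bar> - 2 * L2.K \<le> p2"
      unfolding p2_def ab[symmetric] by (rule L2.translate_pair_ge) (use f' T2 in auto)
    have p1': "2 * L1.height x + 2 * L1.height y + 2 * \<bar>T1\<bar> - 2 * L1.K \<le> p1"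
      if "\<bar>a1\<bar> \<le> R" "\<bar>b1\<bar> \<le> R"
      unfolding p1_def ab[symmetric]
      by (rule L1.translate_pair_ge') (use f' T1 that K ab in auto)
    have p2': "2 * L2.height x + 2 * L2.height y + 2 * \<bar>T2\<bar> - 2 * L2.K \<le> p2"
      if "\<bar>a2\<bar> \<le> R" "\<bar>b2\<bar> \<le> R"
      unfolding p2_def ab[symmetric]
      by (rule L2.translate_pair_ge') (use f' T2 that K ab in auto)
    have ux1: "L1.height x + \<bar>a1\<bar> - K - E \<le> dist u x" "dist u x \<le> E + \<bar>a1\<bar> + L1.height x"
      using L1.dist_ge_heights[of x u] L1.dist_le_heights[of u x] E K
      by (simp_all add: a1_def abs_minus_commute)
    have ux2: "L2.height x + \<bar>a2\<bar> - K - E \<le> dist u x" "dist u x \<le> E + \<bar>a2\<bar> + L2.height x"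
      using L2.dist_ge_heights[of x u] L2.dist_le_heights[of u x] E K
      by (simp_all add: a2_def abs_minus_commute)
    have uy: "dist u y \<le> E + \<bar>b1\<bar> + L1.height y" "dist u y \<le> E + \<bar>b2\<bar> + L2.height y"
      using L1.dist_le_heights[of u y] L2.dist_le_heights[of u y] E
      by (simp_all add: b1_def b2_def abs_minus_commute)
    define m1 m2 where "m1 = max \<bar>a1 - b1\<bar> \<bar>T1\<bar>" and "m2 = max \<bar>a2 - b2\<bar> \<bar>T2\<bar>"
    have m: "\<bar>T1\<bar> \<le> m1" "\<bar>T2\<bar> \<le> m2" "\<bar>b1\<bar> - \<bar>a1\<bar> \<le> m1" "\<bar>b2\<bar> - \<bar>a2\<bar> \<le> m2"
      unfolding m1_def m2_def by linarith+
    note p = p1[folded m1_def] p2[folded m2_def]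
    have h: "0 \<le> L1.height x" "0 \<le> L2.height x" using L1.height_nonneg L2.height_nonneg by auto
    have abs0: "0 \<le> \<bar>a1\<bar>" "0 \<le> \<bar>a2\<bar>" "0 \<le> \<bar>b1\<bar>" "0 \<le> \<bar>b2\<bar>" by auto
    consider "\<bar>a1\<bar> \<le> R" "\<bar>b1\<bar> \<le> R" | "\<bar>a2\<bar> \<le> R" "\<bar>b2\<bar> \<le> R"
      | "\<bar>a1\<bar> \<le> R" "\<bar>b2\<bar> \<le> R" | "\<bar>a2\<bar> \<le> R" "\<bar>b1\<bar> \<le> R"
      using R[of x] R[of y] by (auto simp: a1_def a2_def b1_def b2_def)
    then have "4 * dist u y + 1 \<le> p1 + p2"
    proof cases
      case 1
      from p1'[OF 1] p m ux1 ux2 uy K E T(1)[unfolded T0_def] 1 h abs0 R0 show ?thesis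
        by linarith
    next
      case 2
      from p2'[OF 2] p m ux1 ux2 uy K E T(2)[unfolded T0_def] 2 h abs0 R0 show ?thesis
        by linarith
    next
      case 3
      from p m uy K E T(2)[unfolded T0_def] 3 h abs0 R0 show ?thesis by linarith
    next
      case 4
      from p m uy K E T(1)[unfolded T0_def] 4 h abs0 R0 show ?thesis by linarith
    qed
    then show ?thesis by (simp add: p1_def p2_def)
  qed
  then show ?thesis using that by blast
qed

end

section \<open>Tracking by a geodesic ray\<close>

text \<open>A quantitative form of the equality case \<open>R = r\<close> of the triangle
  inequality. At the fraction \<open>l = r / D\<close> the terms of Stewart's inequality collapse to
  \<open>(1 - l) * (R\<^sup>2 - r\<^sup>2)\<close>.\<close>

lemma CAT0_near_geodesic:
  fixes p q z :: "'x::metric_space"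
  assumes X: "CAT0 TYPE('x)" and c: "geodesic_from_to p q c"
    and r: "0 \<le> r" "r \<le> dist p q" and 1: "dist z q \<le> dist p q - r" and 2: "dist p z \<le> R"
  shows "(dist z (c r))\<^sup>2 \<le> R\<^sup>2 - r\<^sup>2"
proof (cases "dist p q = 0")
  case True
  then have "r = 0" "z = q" "c r = q" using r 1 geodesic_fromD[OF c] by auto
  then show ?thesis by simp
next
  case False
  define D where "D = dist p q"
  have D: "0 < D" using False by (simp add: D_def less_le)
  define l where "l = r / D"
  have l: "0 \<le> l" "l \<le> 1" "l * D = r" using D r by (auto simp: l_def D_def)
  have "0 \<le> R" using 2 zero_le_dist[of p z] by linarith
  have zq: "(dist z q)\<^sup>2 \<le> ((1 - l) * D)\<^sup>2"
    using 1 l by (intro power_mono) (auto simp: D_def algebra_simps)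
  have zp: "(dist z p)\<^sup>2 \<le> R\<^sup>2" using 2 by (intro power_mono) (auto simp: dist_commute)
  have rR: "r\<^sup>2 \<le> R\<^sup>2"
  proof (rule power_mono)
    show "r \<le> R" using dist_triangle[of p q z] 1 2 by (simp add: dist_commute)
  qed (fact r)
  have "(dist z (c r))\<^sup>2 \<le> (1 - l) * (dist z p)\<^sup>2 + l * (dist z q)\<^sup>2 - l * (1 - l) * D\<^sup>2"
    using CAT0_stewart[OF X c l(1,2), of z] l(3) by (simp add: D_def)
  also have "\<dots> \<le> (1 - l) * R\<^sup>2 + l * ((1 - l) * D)\<^sup>2 - l * (1 - l) * D\<^sup>2"
    using l zp zq by (intro diff_mono add_mono mult_left_mono) auto
  also have "\<dots> = (1 - l) * (R\<^sup>2 - (l * D)\<^sup>2)"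
    by (simp add: power2_eq_square algebra_simps)
  also have "\<dots> \<le> 1 * (R\<^sup>2 - (l * D)\<^sup>2)"
    using l rR by (intro mult_right_mono) auto
  finally show ?thesis by (simp add: l)
qed

text \<open>\<^term>\<open>n\<close> is a time from which the walk \<^term>\<open>z\<close> looks almost straight all the way back
  to \<^term>\<open>K\<close>.\<close>
definition straight_time :: "(nat \<Rightarrow> 'x::metric_space) \<Rightarrow> real \<Rightarrow> real \<Rightarrow> nat \<Rightarrow> nat \<Rightarrow> bool" where
  "straight_time z A \<epsilon> K n \<longleftrightarrow>
    (\<forall>k. K \<le> k \<longrightarrow> k \<le> n \<longrightarrow> dist (z k) (z n) \<le> dist (z 0) (z n) - (A - \<epsilon>) * real k)"

text \<open>With \<open>R = (A + \<epsilon>) * k\<close> and \<open>r = (A - \<epsilon>) * k\<close>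
  the difference of squares is \<open>4 * A * \<epsilon> * k\<^sup>2\<close>; this is where the
  square root of \<epsilon> comes from.\<close>

lemma straight_time_near:
  fixes z :: "nat \<Rightarrow> 'x::metric_space"
  assumes X: "CAT0 TYPE('x)" and c: "geodesic_from_to (z 0) (z n) c"
    and n: "straight_time z A \<epsilon> K n" and k: "K \<le> k" "k \<le> n" and \<epsilon>: "0 < \<epsilon>" "\<epsilon> \<le> A"
    and up: "dist (z 0) (z k) \<le> (A + \<epsilon>) * real k"
  shows "(A - \<epsilon>) * real k \<le> dist (z 0) (z n)"
    "dist (z k) (c ((A - \<epsilon>) * real k)) \<le> 2 * sqrt (A * \<epsilon>) * real k"
proof -
  have d: "dist (z k) (z n) \<le> dist (z 0) (z n) - (A - \<epsilon>) * real k"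
    using n k by (simp add: straight_time_def)
  then show r: "(A - \<epsilon>) * real k \<le> dist (z 0) (z n)"
    using zero_le_dist[of "z k" "z n"] by linarith
  have "(dist (z k) (c ((A - \<epsilon>) * real k)))\<^sup>2 \<le> ((A + \<epsilon>) * real k)\<^sup>2 - ((A - \<epsilon>) * real k)\<^sup>2"
    by (rule CAT0_near_geodesic[OF X c _ r d up]) (use \<epsilon> in simp)
  also have "\<dots> = (2 * sqrt (A * \<epsilon>) * real k)\<^sup>2"
    using \<epsilon> by (simp add: power_mult_distrib power2_sum power2_diff algebra_simps)
      (simp add: power2_eq_square)
  finally show "dist (z k) (c ((A - \<epsilon>) * real k)) \<le> 2 * sqrt (A * \<epsilon>) * real k"
    using \<epsilon> by (auto intro: power2_le_imp_le)
qed

text \<open>Geodesics to successive straight times both pass near \<open>z (n i)\<close>; convexity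
  carries this closeness down to every smaller parameter in proportion, so the geodesics converge at
  each fixed parameter.\<close>

lemma CAT0_ray_tracking:
  fixes z :: "nat \<Rightarrow> 'x::complete_space"
  assumes X: "CAT0 TYPE('x)" and A: "0 < A"
    and st: "\<And>\<epsilon>. 0 < \<epsilon> \<Longrightarrow> \<exists>K. \<exists>\<^sub>\<infinity>n. straight_time z A \<epsilon> K n"
    and up: "\<And>\<epsilon>. 0 < \<epsilon> \<Longrightarrow> \<forall>\<^sub>F k in sequentially. dist (z 0) (z k) \<le> (A + \<epsilon>) * real k"
  shows "\<exists>\<gamma>. geodesic_on {0..} \<gamma> \<and> \<gamma> 0 = z 0 \<and>
    (\<lambda>n. 1 / real n * dist (\<gamma> (A * real n)) (z n)) \<longlonglongrightarrow> 0"
proof -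
  \<comment> \<open>Errors are of the order of the square root, so the ratio 1/16 yields relative
    errors of ratio 1/4. The factor \<open>A / 4\<close> makes
    \<open>2 * sqrt (A * \<epsilon> i)\<close> equal to \<open>A * (1/4) ^ i\<close> and keeps
    \<open>A - \<epsilon> i\<close> above \<open>A / 2\<close>.\<close>
  define \<epsilon> where "\<epsilon> i = A / 4 * (1 / 16) ^ i" for i
  have \<epsilon>: "0 < \<epsilon> i" "\<epsilon> i \<le> A / 4" for i using A by (auto simp: \<epsilon>_def power_le_one)
  have sq: "2 * sqrt (A * \<epsilon> i) = A * (1/4) ^ i" for i
  proof -
    have "A * \<epsilon> i = (A / 2 * (1/4) ^ i)\<^sup>2"
      by (simp add: \<epsilon>_def power2_eq_square power_mult_distrib flip: power_add power_mult)
        (simp add: power_add power2_eq_square flip: power_mult_distrib)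
    then show ?thesis using A by simp
  qed
  have "\<exists>K. (\<exists>\<^sub>\<infinity>n. straight_time z A (\<epsilon> i) K n) \<and> (\<forall>k\<ge>K. dist (z 0) (z k) \<le> (A + \<epsilon> i) * real k)" for i
  proof -
    obtain K1 where K1: "\<exists>\<^sub>\<infinity>n. straight_time z A (\<epsilon> i) K1 n" using st \<epsilon> by blast
    obtain K2 where K2: "\<forall>k\<ge>K2. dist (z 0) (z k) \<le> (A + \<epsilon> i) * real k"
      using up \<epsilon> unfolding eventually_sequentially by blast
    have "\<exists>\<^sub>\<infinity>n. straight_time z A (\<epsilon> i) (max K1 K2) n"
      using K1 by (rule INFM_mono) (simp add: straight_time_def)
    then show ?thesis using K2 by (intro exI[of _ "max K1 K2"]) simp
  qed
  then obtain K where K: "\<And>i. \<exists>\<^sub>\<infinity>n. straight_time z A (\<epsilon> i) (K i) n"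
    and Ku: "\<And>i k. K i \<le> k \<Longrightarrow> dist (z 0) (z k) \<le> (A + \<epsilon> i) * real k"
    by metis
  \<comment> \<open>Asking for \<open>n i\<close> beyond \<open>K (Suc i)\<close> makes consecutive
    windows from \<open>K i\<close> to \<open>n i\<close> overlap: \<open>z (n i)\<close> is then
    near both the geodesic of index \<open>i\<close> and the next one, and the windows cover all
    large times.\<close>
  have ex: "\<exists>n. (straight_time z A (\<epsilon> i) (K i) n \<and> K i + K (Suc i) < n) \<and> m < n" for i m
  proof -
    obtain n where "K i + K (Suc i) + m < n" "straight_time z A (\<epsilon> i) (K i) n"
      using K[of i] unfolding INFM_nat by blast
    then show ?thesis by (intro exI[of _ n]) auto
  qed
  have "\<exists>n. \<forall>i. (straight_time z A (\<epsilon> i) (K i) (n i) \<and> K i + K (Suc i) < n i) \<and> n i < n (Suc i)"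
    by (rule dependent_nat_choice) (use ex in blast)+
  then obtain n where n: "\<And>i. straight_time z A (\<epsilon> i) (K i) (n i)"
    and nK: "\<And>i. K i + K (Suc i) < n i" and n_mono: "\<And>i. n i < n (Suc i)" by blast
  have "\<exists>c. \<forall>i. geodesic_from_to (z 0) (z (n i)) (c i)"
    by (rule choice) (use CAT0_geodesic[OF X] in metis)
  then obtain c where c: "\<And>i. geodesic_from_to (z 0) (z (n i)) (c i)" by blast
  have near: "(A - \<epsilon> i) * real k \<le> dist (z 0) (z (n i))"
    "dist (z k) (c i ((A - \<epsilon> i) * real k)) \<le> A * (1/4) ^ i * real k"
    if "K i \<le> k" "k \<le> n i" for i k
  proof -
    have "\<epsilon> i \<le> A" using \<epsilon>(2)[of i] A by linarith
    note * = straight_time_near[OF X c n that \<epsilon>(1) this Ku[OF that(1)]]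
    show "(A - \<epsilon> i) * real k \<le> dist (z 0) (z (n i))" by (fact *(1))
    show "dist (z k) (c i ((A - \<epsilon> i) * real k)) \<le> A * (1/4) ^ i * real k"
      using *(2) unfolding sq .
  qed
  have n_le: "n i \<le> n j" if "i \<le> j" for i j
    by (rule lift_Suc_mono_le[of n, OF less_imp_le[OF n_mono] that])
  define r where "r i = (A - \<epsilon> i) * real (n i)" for i
  have \<epsilon>_le: "\<epsilon> j \<le> \<epsilon> i" if "i \<le> j" for i j
    using that A unfolding \<epsilon>_def by (intro mult_left_mono power_decreasing) auto
  have r_le: "r i \<le> r j" if "i \<le> j" for i j
    unfolding r_def using \<epsilon>_le[OF that] \<epsilon>[of j] A n_le[OF that] by (intro mult_mono) auto
  have r_ge: "A / 2 * real (n i) \<le> r i" for i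
    unfolding r_def using \<epsilon>[of i] A by (intro mult_right_mono) auto
  have D: "r i \<le> dist (z 0) (z (n j))" if "i \<le> j" for i j
    using r_le[OF that] near(1)[of j "n j"] nK[of j] by (simp add: r_def)
  have step: "dist (c i s) (c (Suc i) s) \<le> 4 * (1/4)^i * s"
    if s: "0 \<le> s" "s \<le> r i" for i s
  proof (cases "n i = 0")
    case True
    then show ?thesis using nK[of i] by simp
  next
    case False
    define R where "R = (A - \<epsilon> i) * real (n i)"
    define R' where "R' = (A - \<epsilon> (Suc i)) * real (n i)"
    have sR: "s \<le> R" using s by (simp add: R_def r_def)
    have e: "\<epsilon> (Suc i) \<le> \<epsilon> i" by (simp add: \<epsilon>_le)
    have RR: "R \<le> R'" unfolding R_def R'_def using e by (intro mult_right_mono) auto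
    have R'R: "R' - R \<le> \<epsilon> i * real (n i)"
      using \<epsilon>(1)[of "Suc i"] by (simp add: R_def R'_def left_diff_distrib)
    have R_ge: "A / 2 * real (n i) \<le> R" using r_ge[of i] by (simp add: r_def R_def)
    moreover have An: "0 < A / 2 * real (n i)" using A False by simp
    ultimately have R0: "0 < R" by linarith
    have K': "K i \<le> n i" "K (Suc i) \<le> n i" using nK[of i] by auto
    have n1: "R \<le> dist (z 0) (z (n i))" "dist (z (n i)) (c i R) \<le> A * (1/4)^i * real (n i)"
      using near[of i "n i"] K' by (auto simp: R_def)
    have n2: "R' \<le> dist (z 0) (z (n (Suc i)))"
      "dist (z (n i)) (c (Suc i) R') \<le> A * (1/4)^(Suc i) * real (n i)"
      using near[of "Suc i" "n i"] K'(2) less_imp_le[OF n_mono[of i]] unfolding R'_def by auto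
    have "dist (c (Suc i) R') (c (Suc i) R) \<le> \<epsilon> i * real (n i)"
      using geodesic_fromD(3)[OF c, of R' "Suc i" R] RR R'R R0 n2(1) by simp
    also have "\<epsilon> i * real (n i) \<le> A / 4 * (1/4)^i * real (n i)"
      using A by (intro mult_right_mono) (auto simp: \<epsilon>_def intro!: power_mono)
    finally have n3: "dist (c (Suc i) R') (c (Suc i) R) \<le> A / 4 * (1/4)^i * real (n i)" .
    have "dist (c i R) (c (Suc i) R) \<le> dist (z (n i)) (c i R) + dist (z (n i)) (c (Suc i) R')
      + dist (c (Suc i) R') (c (Suc i) R)"
      by (smt (verit) dist_commute dist_triangle)
    also have "\<dots> \<le> 2 * A * (1/4)^i * real (n i)"
    proof -
      have "0 \<le> A * (1/4)^i * real (n i)" using A by simp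
      then show ?thesis using n1(2) n2(2) n3 by simp
    qed
    finally have end_R: "dist (c i R) (c (Suc i) R) \<le> 2 * A * (1/4)^i * real (n i)" .
    \<comment> \<open>Convexity scales the gap at \<open>R\<close> down to \<open>s\<close>; since
      \<open>R\<close> is at least \<open>A / 2 * real (n i)\<close>, the factor
      \<open>real (n i)\<close> cancels.\<close>
    have "dist (c i s) (c (Suc i) s) \<le> s / R * dist (c i R) (c (Suc i) R)"
      by (rule CAT0_convex[OF X c c]) (use n1(1) n2(1) RR R0 s sR in auto)
    also have "\<dots> \<le> s / (A / 2 * real (n i)) * (2 * A * (1/4)^i * real (n i))"
      using end_R s R_ge An by (intro mult_mono frac_le) auto
    also have "\<dots> = 4 * (1/4)^i * s" using A False by (simp add: field_simps)
    finally show ?thesis .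
  qed
  have steps: "dist (c i s) (c (i + m) s) \<le> 6 * (1/4)^i * s"
    if s: "0 \<le> s" "s \<le> r i" for i m s
  proof -
    have "dist (c i s) (c (i + m) s) \<le> 4 * s * (\<Sum>j<m. (1/4)^(i + j))"
    proof (induction m)
      case (Suc m)
      have "s \<le> r (i + m)" using s(2) r_le[of i "i + m"] by simp
      then have "dist (c (i + m) s) (c (i + Suc m) s) \<le> 4 * (1/4)^(i + m) * s"
        using step[of s "i + m"] s(1) by simp
      with Suc dist_triangle[of "c i s" "c (i + Suc m) s" "c (i + m) s"] show ?case
        by (simp add: algebra_simps)
    qed simp
    also have "(\<Sum>j<m. (1/4::real)^(i + j)) = (1/4)^i * (\<Sum>j<m. (1/4)^j)"
      by (simp add: power_add sum_distrib_left)
    \<comment> \<open>The geometric series contributes 4/3, and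
      \<open>4 * (4/3) \<le> 6\<close>.\<close>
    also have "(\<Sum>j<m. (1/4::real)^j) \<le> (\<Sum>j. (1/4)^j)"
      by (rule sum_le_suminf) auto
    also have "(\<Sum>j. (1/4::real)^j) = 4/3" by (subst suminf_geometric) auto
    finally have "dist (c i s) (c (i + m) s) \<le> 4 * s * ((1/4)^i * (4/3))"
      using s by (simp add: mult_left_mono)
    also have "\<dots> \<le> 6 * (1/4)^i * s" using s by (simp add: mult_right_mono)
    finally show ?thesis .
  qed
  have n_ge: "i \<le> n i" for i by (induction i) (use n_mono in \<open>auto intro: Suc_leI le_less_trans\<close>)
  have big: "\<exists>i. s \<le> r i" for s
  proof -
    obtain i where "2 * s / A \<le> real i" using real_arch_simple by blast
    also have "real i \<le> real (n i)" using n_ge by simp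
    finally have "s \<le> A / 2 * real (n i)" using A by (simp add: field_simps)
    with r_ge[of i] show ?thesis by (intro exI[of _ i]) simp
  qed
  have "\<exists>l. (\<lambda>i. c i s) \<longlonglongrightarrow> l" if s: "0 \<le> s" for s
  proof -
    obtain i0 where i0: "s \<le> r i0" using big by blast
    have "Cauchy (\<lambda>i. c i s)"
    proof (rule metric_CauchyI)
      fix e :: real assume e: "0 < e"
      have "(\<lambda>i. 6 * (1/4)^i * s) \<longlonglongrightarrow> 6 * 0 * s"
        by (intro tendsto_intros LIMSEQ_power_zero) auto
      then have "\<forall>\<^sub>F i in sequentially. 6 * (1/4)^i * s < e / 2"
        using e by (intro order_tendstoD(2)) auto
      then obtain i1 where i1: "\<And>i. i1 \<le> i \<Longrightarrow> 6 * (1/4)^i * s < e / 2"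
        unfolding eventually_sequentially by blast
      let ?i = "max i0 i1"
      have si: "s \<le> r ?i" using i0 r_le[of i0 ?i] by simp
      have *: "dist (c ?i s) (c i s) < e / 2" if "?i \<le> i" for i
        using steps[OF s si, of "i - ?i"] i1[of ?i] that by simp
      have "dist (c i s) (c j s) < e" if "?i \<le> i" "?i \<le> j" for i j
        using *[OF that(1)] *[OF that(2)] by (rule dist_triangle_half_r)
      then show "\<exists>M. \<forall>i\<ge>M. \<forall>j\<ge>M. dist (c i s) (c j s) < e" by blast
    qed
    then show ?thesis by (simp add: Cauchy_convergent_iff convergent_def)
  qed
  then obtain \<gamma> where \<gamma>: "\<And>s. 0 \<le> s \<Longrightarrow> (\<lambda>i. c i s) \<longlonglongrightarrow> \<gamma> s" by metis
  have ray: "geodesic_on {0..} \<gamma>"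
    unfolding geodesic_on_def
  proof (intro ballI)
    fix s t :: real assume st: "s \<in> {0..}" "t \<in> {0..}"
    obtain i0 where i0: "max s t \<le> r i0" using big by blast
    have "dist (c i s) (c i t) = \<bar>s - t\<bar>" if "i0 \<le> i" for i
      using geodesic_fromD(3)[OF c, of s i t] st i0 D[OF that] by auto
    then have "(\<lambda>i. dist (c i s) (c i t)) \<longlonglongrightarrow> \<bar>s - t\<bar>"
      by (intro tendsto_eventually eventually_sequentiallyI)
    moreover have "(\<lambda>i. dist (c i s) (c i t)) \<longlonglongrightarrow> dist (\<gamma> s) (\<gamma> t)"
      using \<gamma> st by (intro tendsto_dist) auto
    ultimately show "dist (\<gamma> s) (\<gamma> t) = \<bar>s - t\<bar>" by (rule LIMSEQ_unique[symmetric])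
  qed
  have \<gamma>0: "\<gamma> 0 = z 0"
    using \<gamma>[of 0] geodesic_fromD(1)[OF c] by (simp add: LIMSEQ_const_iff)
  have c\<gamma>: "dist (c i s) (\<gamma> s) \<le> 6 * (1/4)^i * s" if s: "0 \<le> s" "s \<le> r i" for i s
  proof (rule LIMSEQ_le_const2)
    show "(\<lambda>m. dist (c i s) (c (m + i) s)) \<longlonglongrightarrow> dist (c i s) (\<gamma> s)"
      by (intro tendsto_intros LIMSEQ_ignore_initial_segment \<gamma> s)
    show "\<exists>N. \<forall>m\<ge>N. dist (c i s) (c (m + i) s) \<le> 6 * (1/4)^i * s"
      using steps[OF s] by (auto simp: add.commute)
  qed
  have bound: "dist (\<gamma> (A * real k)) (z k) \<le> 8 * A * (1/4)^i * real k"
    if k: "K i \<le> k" "k \<le> n i" for i k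
  proof -
    define s where "s = (A - \<epsilon> i) * real k"
    have s: "0 \<le> s" "s \<le> A * real k" "s \<le> r i"
      using \<epsilon>[of i] A k by (auto simp: s_def r_def intro!: mult_left_mono mult_right_mono)
    have "dist (\<gamma> (A * real k)) (\<gamma> s) = A * real k - s"
      using ray s by (simp add: geodesic_on_def)
    also have "\<dots> = \<epsilon> i * real k" by (simp add: s_def algebra_simps)
    also have "\<dots> \<le> A * (1/4)^i * real k"
    proof (rule mult_right_mono)
      have "\<epsilon> i \<le> A / 4 * (1/4)^i"
        using A unfolding \<epsilon>_def by (intro mult_left_mono power_mono) auto
      moreover have "0 \<le> A * (1/4)^i" using A by simp
      ultimately show "\<epsilon> i \<le> A * (1/4)^i" by linarith
    qed simp
    finally have 1: "dist (\<gamma> (A * real k)) (\<gamma> s) \<le> A * (1/4)^i * real k" .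
    have "dist (c i s) (\<gamma> s) \<le> 6 * (1/4)^i * s" by (rule c\<gamma>) fact+
    also have "\<dots> \<le> 6 * (1/4)^i * (A * real k)" using s by (intro mult_left_mono) auto
    finally have 2: "dist (c i s) (\<gamma> s) \<le> 6 * A * (1/4)^i * real k" by (simp add: mult_ac)
    have 3: "dist (z k) (c i s) \<le> A * (1/4)^i * real k"
      using near(2)[OF k] by (simp add: s_def)
    have "dist (\<gamma> (A * real k)) (z k) \<le> dist (\<gamma> (A * real k)) (\<gamma> s) + dist (c i s) (\<gamma> s) + dist (z k) (c i s)"
      by (smt (verit) dist_commute dist_triangle)
    with 1 2 3 show ?thesis by simp
  qed
  have "(\<lambda>k. 1 / real k * dist (\<gamma> (A * real k)) (z k)) \<longlonglongrightarrow> 0"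
  proof (rule LIMSEQ_I)
    fix e :: real assume e: "0 < e"
    have "(\<lambda>i. 8 * A * (1/4)^i) \<longlonglongrightarrow> 8 * A * 0"
      by (intro tendsto_intros LIMSEQ_power_zero) auto
    then have "\<forall>\<^sub>F i in sequentially. 8 * A * (1/4)^i < e"
      using e by (intro order_tendstoD(2)) auto
    then obtain i0 where i0: "\<And>i. i0 \<le> i \<Longrightarrow> 8 * A * (1/4)^i < e"
      unfolding eventually_sequentially by blast
    have "1 / real k * dist (\<gamma> (A * real k)) (z k) < e" if k: "n i0 < k" for k
    proof -
      \<comment> \<open>The first window ending at or after \<open>k\<close>: minimality puts
        \<open>k\<close> after the end of the previous window, hence after \<open>K m\<close>. As
        \<open>k\<close> grows so does \<open>m\<close>, and the relative error tends to 0.\<close>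
      define m where "m = (LEAST m. k \<le> n m)"
      have km: "k \<le> n m" unfolding m_def using n_ge[of k] by (rule LeastI)
      have "i0 < m"
        using km k n_le[of m i0] by (cases "i0 < m") auto
      then obtain j where j: "m = Suc j" "i0 \<le> j" by (cases m) auto
      have "\<not> k \<le> n j" using not_less_Least[of j "\<lambda>m. k \<le> n m"] j by (simp add: m_def)
      then have "K m \<le> k" using nK[of j] j by simp
      from bound[OF this km] have "dist (\<gamma> (A * real k)) (z k) \<le> 8 * A * (1/4)^m * real k" .
      then have "1 / real k * dist (\<gamma> (A * real k)) (z k) \<le> 8 * A * (1/4)^m"
        using k by (simp add: field_simps)
      with i0[of m] j show ?thesis by simp
    qed
    then show "\<exists>N. \<forall>k\<ge>N. norm (1 / real k * dist (\<gamma> (A * real k)) (z k) - 0) < e"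
      by (intro exI[of _ "Suc (n i0)"]) auto
  qed
  with ray \<gamma>0 show ?thesis by blast
qed

section \<open>Ergodic theory of increments\<close>

text \<open>The limit is kept as an infimum: the bound \<open>l * real n \<le> u n\<close> at each
  finite \<open>n\<close> supplies the linear growth of means that the leader argument
  consumes.\<close>

lemma fekete:
  fixes u :: "nat \<Rightarrow> real"
  assumes sub: "\<And>m n. u (m + n) \<le> u m + u n" and nonneg: "\<And>n. 0 \<le> u n"
  obtains l where "(\<lambda>n. u n / real n) \<longlonglongrightarrow> l" "\<And>n. l * real n \<le> u n"
proof -
  define l where "l = (INF n\<in>{1..}. u n / real n)"
  have bdd: "bdd_below ((\<lambda>n. u n / real n) ` {1..})"
    by (rule bdd_belowI[of _ 0]) (use nonneg in auto)
  have lower: "l \<le> u n / real n" if "1 \<le> n" for n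
    unfolding l_def by (rule cINF_lower[OF bdd]) (use that in simp)
  have mult: "u (Suc q * m) \<le> real (Suc q) * u m" for q m
  proof (induction q)
    case (Suc q)
    then show ?case using sub[of m "Suc q * m"] by (simp add: algebra_simps)
  qed simp
  have "(\<lambda>n. u n / real n) \<longlonglongrightarrow> l"
  proof (rule LIMSEQ_I)
    fix e :: real assume e: "0 < e"
    have "\<exists>m\<in>{1..}. u m / real m < l + e / 2"
      using cINF_less_iff[OF _ bdd, of "l + e/2"] e unfolding l_def by auto
    then obtain m where m: "1 \<le> m" "u m / real m < l + e / 2" by auto
    define B where "B = (\<Sum>r<m. u r) + u m"
    have B: "u r \<le> B" if "r < m" for r
      using member_le_sum[of r "{..<m}" u] that nonneg by (simp add: B_def add_increasing2)
    have "0 \<le> B" unfolding B_def by (intro add_nonneg_nonneg sum_nonneg nonneg)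
    have up: "u n / real n \<le> u m / real m + B / real n" if n: "m \<le> n" for n
    proof -
      have "n div m \<noteq> 0" using n m by (simp add: div_eq_0_iff)
      then obtain q where q: "n div m = Suc q" using not0_implies_Suc by blast
      have "u n \<le> u (n div m * m) + u (n mod m)" using sub[of "n div m * m" "n mod m"] by simp
      also have "\<dots> \<le> real (n div m) * u m + B"
        using mult[of q m] q B m(1) by (intro add_mono) auto
      also have "real (n div m) * u m \<le> real n / real m * u m"
      proof (rule mult_right_mono)
        have "real (n div m) * real m \<le> real n"
          unfolding of_nat_mult[symmetric] by (simp del: of_nat_mult)
        then show "real (n div m) \<le> real n / real m" using m(1) by (simp add: field_simps)
      qed (rule nonneg)
      finally have "u n \<le> real n / real m * u m + B" by simp
      then show ?thesis using n m(1) by (simp add: field_simps)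
    qed
    obtain N where N: "2 * B / e < real N" using reals_Archimedean2 by blast
    have "norm (u n / real n - l) < e" if "max m N \<le> n" for n
    proof -
      have n: "m \<le> n" "N \<le> n" "1 \<le> n" using that m by auto
      have "2 * B / e < real n" using N n(2) by simp
      then have "B / real n < e / 2" using n e by (simp add: field_simps)
      with up[OF n(1)] m(2) lower[OF n(3)] e show ?thesis unfolding real_norm_def by linarith
    qed
    then show "\<exists>N. \<forall>n\<ge>N. norm (u n / real n - l) < e" by blast
  qed
  moreover have "l * real n \<le> u n" for n
    using lower[of n] nonneg[of n] by (cases "n = 0") (auto simp: field_simps)
  ultimately show ?thesis using that by blast
qed

text \<open>F. Riesz's lemma on leaders, stated for the complementary set of indices.\<close>
lemma sum_nonleaders_ge:
  fixes v :: "nat \<Rightarrow> real"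
  assumes "i \<le> n"
  shows "v i - v n \<le> (\<Sum>j\<in>{i..<n}. if \<forall>k\<in>{j..n}. v k \<le> v j then v j - v (Suc j) else 0)"
  using assms
proof (induction "n - i" arbitrary: i rule: less_induct)
  case less
  define t where "t j = (if \<forall>k\<in>{j..n}. v k \<le> v j then v j - v (Suc j) else 0)" for j
  have t_nonneg: "0 \<le> t j" if "j < n" for j using that by (auto simp: t_def)
  show ?case
    unfolding t_def[symmetric]
  proof (cases "i = n")
    case False
    then have "i < n" using less.prems by simp
    show "v i - v n \<le> sum t {i..<n}"
    proof (cases "\<forall>k\<in>{i..n}. v k \<le> v i")
      case True
      have "v (Suc i) - v n \<le> sum t {Suc i..<n}"
        using less.hyps[of "Suc i"] \<open>i < n\<close> unfolding t_def[symmetric] by simp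
      moreover have "sum t {i..<n} = t i + sum t {Suc i..<n}"
        using \<open>i < n\<close> by (rule sum.atLeast_Suc_lessThan)
      moreover have "t i = v i - v (Suc i)" using True by (simp add: t_def)
      ultimately show ?thesis by simp
    next
      case False
      \<comment> \<open>Jumping from \<open>i\<close> to a larger value at \<open>k\<close> only
        raises the left side, and the skipped summands are nonnegative.\<close>
      then obtain k where k: "i \<le> k" "k \<le> n" "v i < v k" by (auto simp: not_le)
      then have "i < k" by (cases "i = k") auto
      then have "v k - v n \<le> sum t {k..<n}"
        using less.hyps[of k] k \<open>i < n\<close> unfolding t_def[symmetric] by simp
      also have "\<dots> \<le> sum t {i..<n}"
        using k t_nonneg by (intro sum_mono2) auto
      finally show ?thesis using k by simp
    qed
  qed simp
qed

lemma (in prob_space) measure_preserving_funpow: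
  assumes "T \<in> measurable M M" "distr M M T = M"
  shows "T ^^ i \<in> measurable M M" "distr M M (T ^^ i) = M"
proof -
  have "T ^^ i \<in> measurable M M \<and> distr M M (T ^^ i) = M"
  proof (induction i)
    case (Suc i)
    then have 1: "T ^^ i \<in> measurable M M" "distr M M (T ^^ i) = M" by auto
    have "distr M M (T \<circ> T ^^ i) = distr (distr M M (T ^^ i)) M T"
      using distr_distr[OF assms(1) 1(1)] by simp
    also have "\<dots> = M" using assms 1(2) by simp
    finally have "distr M M (T \<circ> T ^^ i) = M" .
    moreover have "T \<circ> T ^^ i \<in> measurable M M"
      by (rule measurable_comp[OF 1(1) assms(1)])
    ultimately show ?case unfolding funpow.simps by blast
  qed (simp add: id_def)
  then show "T ^^ i \<in> measurable M M" "distr M M (T ^^ i) = M" by auto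
qed

text \<open>Let \<open>\<Psi> m\<close> be the event that time 0 dominates the orbit up to time
  \<open>m\<close>. Riesz's lemma bounds \<open>b n\<close> by the sum of
  \<open>\<bar>b 1\<bar>\<close> over those times whose shifted point lies in the corresponding
  \<open>\<Psi>\<close>. After integration and invariance, the integrals of
  \<open>\<bar>b 1\<bar>\<close> over \<open>\<Psi> 1\<close>, ..., \<open>\<Psi> n\<close> sum to
  at least \<open>\<epsilon> * n\<close>, so they cannot tend to 0. By dominated convergence,
  \<open>\<Psi> m\<close> must occur infinitely often with positive probability.\<close>

lemma (in prob_space) prob_recurrent_maxima_pos:
  fixes b :: "nat \<Rightarrow> 'a \<Rightarrow> real"
  assumes T: "T \<in> measurable M M" "distr M M T = M"
    and int: "\<And>n. integrable M (b n)" and b0: "\<And>x. b 0 x = 0"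
    and sub: "\<And>n x. x \<in> space M \<Longrightarrow> b (Suc n) x \<le> b 1 x + b n (T x)"
    and \<epsilon>: "0 < \<epsilon>" "\<And>n. \<epsilon> * real n \<le> expectation (b n)"
  shows "{x \<in> space M. \<exists>\<^sub>\<infinity>n. \<forall>k\<le>n. b (n - k) ((T ^^ k) x) \<le> b n x} \<in> sets M"
    and "0 < prob {x \<in> space M. \<exists>\<^sub>\<infinity>n. \<forall>k\<le>n. b (n - k) ((T ^^ k) x) \<le> b n x}"
proof -
  note Tk = measure_preserving_funpow[OF T]
  have [measurable]: "b n \<in> borel_measurable M" for n using int by auto
  have [measurable]: "T ^^ i \<in> measurable M M" for i by (rule Tk)
  define \<Psi> where "\<Psi> m = {x \<in> space M. \<forall>k\<le>m. b (m - k) ((T ^^ k) x) \<le> b m x}" for m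
  have [measurable]: "\<Psi> m \<in> sets M" for m unfolding \<Psi>_def by measurable
  have E_eq: "{x \<in> space M. \<exists>\<^sub>\<infinity>n. \<forall>k\<le>n. b (n - k) ((T ^^ k) x) \<le> b n x}
      = {x \<in> space M. \<exists>\<^sub>\<infinity>n. x \<in> \<Psi> n}" by (auto simp: \<Psi>_def)
  have E_meas: "{x \<in> space M. \<exists>\<^sub>\<infinity>n. x \<in> \<Psi> n} \<in> sets M"
    unfolding INFM_nat_le by measurable
  then show "{x \<in> space M. \<exists>\<^sub>\<infinity>n. \<forall>k\<le>n. b (n - k) ((T ^^ k) x) \<le> b n x} \<in> sets M"
    by (simp add: E_eq)
  define h where "h x = \<bar>b 1 x\<bar>" for x
  have h_int: "integrable M h" unfolding h_def using int by auto
  have [measurable]: "h \<in> borel_measurable M" using h_int by auto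
  define f where "f m x = indicator (\<Psi> m) x * h x" for m x
  have f_int: "integrable M (f m)" for m
    unfolding f_def using integrable_mult_indicator[of "\<Psi> m" M h] h_int by simp
  have [measurable]: "f m \<in> borel_measurable M" for m using f_int by auto
  have f_T: "integrable M (\<lambda>x. f m ((T ^^ i) x))" "expectation (\<lambda>x. f m ((T ^^ i) x)) = expectation (f m)" for m i
    using integrable_distr_eq[of "T ^^ i" M M "f m"] integral_distr[of "T ^^ i" M M "f m"] f_int
    by (auto simp: Tk)
  have pointwise: "b n x \<le> (\<Sum>i<n. f (n - i) ((T ^^ i) x))" if x: "x \<in> space M" for n x
  proof -
    \<comment> \<open>The value still to be collected from time \<open>i\<close> to time
      \<open>n\<close>; \<open>j\<close> dominates all later indices exactly when the point shifted
      by \<open>j\<close> lies in \<open>\<Psi> (n - j)\<close>.\<close>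
    define v where "v i = b (n - i) ((T ^^ i) x)" for i
    have Tx: "(T ^^ i) x \<in> space M" for i using x measurable_space[OF Tk(1)] by blast
    have "b n x = v 0 - v n" by (simp add: v_def b0)
    also have "\<dots> \<le> (\<Sum>j\<in>{0..<n}. if \<forall>k\<in>{j..n}. v k \<le> v j then v j - v (Suc j) else 0)"
      by (rule sum_nonleaders_ge) simp
    also have "\<dots> \<le> (\<Sum>i\<in>{0..<n}. f (n - i) ((T ^^ i) x))"
    proof (rule sum_mono)
      fix j assume "j \<in> {0..<n}"
      then have j: "j < n" by simp
      show "(if \<forall>k\<in>{j..n}. v k \<le> v j then v j - v (Suc j) else 0) \<le> f (n - j) ((T ^^ j) x)"
      proof (cases "\<forall>k\<in>{j..n}. v k \<le> v j")
        case True
        have "(T ^^ j) x \<in> \<Psi> (n - j)"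
          unfolding \<Psi>_def
        proof (intro CollectI conjI allI impI Tx)
          fix k assume "k \<le> n - j"
          then have "v (k + j) \<le> v j" using True j by auto
          moreover have "(T ^^ k) ((T ^^ j) x) = (T ^^ (k + j)) x" by (simp add: funpow_add)
          ultimately show "b (n - j - k) ((T ^^ k) ((T ^^ j) x)) \<le> b (n - j) ((T ^^ j) x)"
            by (simp add: v_def add.commute)
        qed
        then have "f (n - j) ((T ^^ j) x) = h ((T ^^ j) x)" by (simp add: f_def)
        moreover have "v j \<le> b 1 ((T ^^ j) x) + v (Suc j)"
          using sub[OF Tx, of "n - Suc j" j] j by (simp add: v_def Suc_diff_Suc)
        ultimately show ?thesis using True unfolding h_def by simp
      next
        case False
        then show ?thesis by (auto simp: f_def h_def)
      qed
    qed
    finally show ?thesis by (simp add: atLeast0LessThan)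
  qed
  have mean: "\<epsilon> * real n \<le> (\<Sum>m\<in>{1..n}. expectation (f m))" for n
  proof -
    have "\<epsilon> * real n \<le> expectation (b n)" by (rule \<epsilon>)
    also have "\<dots> \<le> expectation (\<lambda>x. \<Sum>i<n. f (n - i) ((T ^^ i) x))"
      using pointwise by (intro integral_mono int Bochner_Integration.integrable_sum f_T)
    also have "\<dots> = (\<Sum>i<n. expectation (f (n - i)))"
      by (simp add: Bochner_Integration.integral_sum f_T)
    also have "\<dots> = (\<Sum>m\<in>{1..n}. expectation (f m))"
      by (rule sum.reindex_bij_witness[of _ "\<lambda>m. n - m" "\<lambda>i. n - i"]) auto
    finally show ?thesis .
  qed
  have "0 < prob {x \<in> space M. \<exists>\<^sub>\<infinity>n. x \<in> \<Psi> n}"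
  proof (rule ccontr)
    assume "\<not> ?thesis"
    then have "prob {x \<in> space M. \<exists>\<^sub>\<infinity>n. x \<in> \<Psi> n} = 0" by (simp add: zero_less_measure_iff)
    then have "{x \<in> space M. \<exists>\<^sub>\<infinity>n. x \<in> \<Psi> n} \<in> null_sets M"
      using E_meas by (simp add: measure_eq_emeasure_eq_ennreal null_setsI emeasure_eq_measure)
    then have "AE x in M. \<not> (\<exists>\<^sub>\<infinity>n. x \<in> \<Psi> n)"
      by (auto dest!: AE_not_in elim!: AE_mp)
    then have lim: "AE x in M. (\<lambda>m. f m x) \<longlonglongrightarrow> 0"
    proof eventually_elim
      case (elim x)
      then have "\<forall>\<^sub>F m in sequentially. x \<notin> \<Psi> m"
        by (simp add: not_frequently cofinite_eq_sequentially)
      then show ?case by (rule tendsto_eventually[OF eventually_mono]) (simp add: f_def)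
    qed
    have "(\<lambda>m. expectation (f m)) \<longlonglongrightarrow> expectation (\<lambda>x. 0)"
      by (rule integral_dominated_convergence[where w = h])
        (use h_int lim in \<open>auto simp: f_def h_def indicator_def\<close>)
    then have "(\<lambda>m. expectation (f m)) \<longlonglongrightarrow> 0" by simp
    then have "\<forall>\<^sub>F m in sequentially. expectation (f m) < \<epsilon> / 2"
      using \<epsilon>(1) by (intro order_tendstoD(2)) auto
    then obtain m0 where m0: "\<And>m. m0 \<le> m \<Longrightarrow> expectation (f m) < \<epsilon> / 2"
      unfolding eventually_sequentially by blast
    define H where "H = expectation h"
    have H0: "0 \<le> H" unfolding H_def h_def by (intro integral_nonneg_AE) auto
    have H: "expectation (f m) \<le> H" for m
      unfolding H_def by (intro integral_mono f_int h_int) (auto simp: f_def h_def indicator_def)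
    \<comment> \<open>Cesaro step: the terms below \<open>m0\<close> cost a bounded total, the
      others at most half of \<epsilon> each, which linear growth at rate \<epsilon>
      contradicts.\<close>
    have half: "\<epsilon> * real n \<le> \<epsilon> / 2 * real n + real m0 * H" for n
    proof -
      have "\<epsilon> * real n \<le> (\<Sum>m\<in>{1..n}. expectation (f m))" by (rule mean)
      also have "\<dots> \<le> (\<Sum>m\<in>{1..n}. \<epsilon> / 2 + (if m < m0 then H else 0))"
        using m0 H \<epsilon>(1) H0 by (intro sum_mono) (fastforce simp: not_less intro: add_increasing less_imp_le)
      also have "\<dots> = \<epsilon> / 2 * real n + (\<Sum>m\<in>{1..n} \<inter> {..<m0}. H)"
        by (simp add: sum.distrib sum.If_cases lessThan_def)
      also have "(\<Sum>m\<in>{1..n} \<inter> {..<m0}. H) \<le> (\<Sum>m\<in>{..<m0}. H)"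
        using H0 by (intro sum_mono2) auto
      finally show ?thesis by simp
    qed
    have le: "\<epsilon> * real n \<le> 2 * (real m0 * H)" for n using half[of n] by simp
    obtain n where "2 * (real m0 * H) / \<epsilon> < real n" using reals_Archimedean2 by blast
    then have "2 * (real m0 * H) < \<epsilon> * real n"
      using \<epsilon>(1) by (simp add: pos_divide_less_eq mult.commute)
    with le[of n] show False by simp
  qed
  then show "0 < prob {x \<in> space M. \<exists>\<^sub>\<infinity>n. \<forall>k\<le>n. b (n - k) ((T ^^ k) x) \<le> b n x}"
    by (simp add: E_eq)
qed

section \<open>The shift on increments and the zero-one law\<close>

definition drop_seq :: "nat \<Rightarrow> (nat \<Rightarrow> 'a) \<Rightarrow> nat \<Rightarrow> 'a" where
  "drop_seq k \<omega> = (\<lambda>i. \<omega> (i + k))"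

lemma drop_seq_0 [simp]: "drop_seq 0 \<omega> = \<omega>"
  by (simp add: drop_seq_def)

lemma drop_seq_drop_seq [simp]: "drop_seq j (drop_seq k \<omega>) = drop_seq (j + k) \<omega>"
  by (simp add: drop_seq_def ac_simps)

lemma funpow_drop_seq: "(drop_seq k ^^ i) \<omega> = drop_seq (i * k) \<omega>"
  by (induction i) simp_all

lemma space_increments: "space (increments \<mu>) = {\<omega>. \<forall>i. \<omega> i \<in> space \<mu>}"
  by (auto simp: increments_def space_PiM)

context
  fixes \<mu> :: "'a measure"
  assumes prob: "prob_space \<mu>"
begin

lemma prob_space_increments: "prob_space (increments \<mu>)"
  unfolding increments_def using prob by (intro prob_space_PiM)

lemma measurable_coord [measurable]: "(\<lambda>\<omega>. \<omega> i) \<in> measurable (increments \<mu>) \<mu>"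
  unfolding increments_def by (rule measurable_component_singleton) simp

lemma measurable_drop_seq [measurable]: "drop_seq k \<in> measurable (increments \<mu>) (increments \<mu>)"
  unfolding drop_seq_def[abs_def] increments_def
  by (rule measurable_PiM_single') (auto simp: space_PiM)

lemma distr_drop_seq: "distr (increments \<mu>) (increments \<mu>) (drop_seq k) = increments \<mu>"
  using distr_PiM_reindex[of UNIV "\<lambda>_::nat. \<mu>" "\<lambda>i. i + k" UNIV] prob
  by (simp add: increments_def drop_seq_def[abs_def] restrict_UNIV)

lemma distr_coord: "distr (increments \<mu>) \<mu> (\<lambda>\<omega>. \<omega> i) = \<mu>"
  unfolding increments_def by (rule distr_PiM_component) (use prob in auto)

text \<open>Since \<open>i \<le> k i\<close>, hitting \<open>E\<close> for infinitely many
  \<open>i\<close> is a tail event, and by shift invariance its probability is at least that of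
  \<open>E\<close>; Kolmogorov's law makes it 1. A general \<open>k\<close> allows the shifts to be
  confined to one residue class.\<close>

lemma AE_drop_seq_hits:
  assumes E: "E \<in> sets (increments \<mu>)" "0 < measure (increments \<mu>) E"
    and k: "\<And>i. i \<le> k i"
  shows "AE \<omega> in increments \<mu>. \<exists>i. drop_seq (k i) \<omega> \<in> E"
proof -
  let ?S = "increments \<mu>"
  interpret S: prob_space ?S by (rule prob_space_increments)
  define F where "F i = {(\<lambda>\<omega>. \<omega> i) -` A \<inter> space ?S | A. A \<in> sets \<mu>}" for i :: nat
  have F_sa: "sigma_algebra (space ?S) (F i)" for i
  proof -
    have "F i = sets (vimage_algebra (space ?S) (\<lambda>\<omega>. \<omega> i) \<mu>)"
      unfolding F_def by (rule sets_vimage_algebra2[symmetric]) (simp add: space_increments)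
    then show ?thesis using sets.sigma_algebra_axioms by (metis space_vimage_algebra)
  qed
  have indep: "S.indep_sets F UNIV"
  proof -
    have "S.indep_vars (\<lambda>_. \<mu>) (\<lambda>i \<omega>. \<omega> i) UNIV"
    proof (subst S.indep_vars_iff_distr_eq_PiM)
      show "distr ?S (Pi\<^sub>M UNIV (\<lambda>_. \<mu>)) (\<lambda>x. \<lambda>i\<in>UNIV. x i) = Pi\<^sub>M UNIV (\<lambda>i. distr ?S \<mu> (\<lambda>\<omega>. \<omega> i))"
        unfolding distr_coord using distr_id[of ?S] by (simp add: restrict_UNIV increments_def)
    qed simp_all
    then show ?thesis unfolding S.indep_vars_def2 F_def by simp
  qed
  define A where "A i = drop_seq (k i) -` E \<inter> space ?S" for i
  have [measurable]: "A i \<in> sets ?S" for i unfolding A_def using E(1) by (intro measurable_sets) auto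
  have PA: "measure ?S (A i) = measure ?S E" for i
    using measure_distr[of "drop_seq (k i)" ?S ?S E] E(1) by (simp add: A_def distr_drop_seq)
  define W where "W = (\<Inter>j. \<Union>i\<in>{j..}. A i)"
  have dec: "decseq (\<lambda>j. \<Union>i\<in>{j..}. A i)" unfolding decseq_def by force
  have W_meas: "W \<in> sets ?S" unfolding W_def by measurable
  have "W \<in> S.tail_events F"
    unfolding S.tail_events_def
  proof (intro INT_I)
    fix n
    define N where "N = sigma (space ?S) (\<Union>i\<in>{n..}. F i)"
    have FP: "(\<Union>i\<in>{n..}. F i) \<subseteq> Pow (space ?S)" by (auto simp: F_def)
    have N: "space N = space ?S" "sets N = sigma_sets (space ?S) (\<Union>i\<in>{n..}. F i)"
      unfolding N_def using FP by (auto simp: space_measure_of sets_measure_of)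
    have coord: "(\<lambda>\<omega>. \<omega> i) \<in> measurable N \<mu>" if "n \<le> i" for i
    proof (rule measurableI)
      fix B assume "B \<in> sets \<mu>"
      then have "(\<lambda>\<omega>. \<omega> i) -` B \<inter> space N \<in> (\<Union>i\<in>{n..}. F i)" using that by (auto simp: F_def N)
      then show "(\<lambda>\<omega>. \<omega> i) -` B \<inter> space N \<in> sets N" by (simp add: N(2) sigma_sets.Basic)
    qed (simp add: N(1) space_increments)
    have drop_meas: "drop_seq m \<in> measurable N ?S" if "n \<le> m" for m
      unfolding drop_seq_def[abs_def] increments_def
    proof (rule measurable_PiM_single')
      show "(\<lambda>\<omega>. \<omega> (i + m)) \<in> measurable N \<mu>" for i using that by (intro coord) simp
    qed (auto simp: N(1) space_increments)
    have AN: "A i \<in> sets N" if "n \<le> i" for i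
    proof -
      have "drop_seq (k i) -` E \<inter> space N \<in> sets N"
        by (rule measurable_sets[OF drop_meas E(1)]) (use k[of i] that in simp)
      then show ?thesis by (simp add: A_def N(1))
    qed
    have "(\<Inter>j. \<Union>i\<in>{j..}. A (n + i)) \<in> sets N"
    proof -
      have [measurable]: "A (n + i) \<in> sets N" for i by (rule AN) simp
      show ?thesis by measurable
    qed
    \<comment> \<open>A limsup of events does not change when the first \<open>n\<close> are
      dropped; the remaining ones depend only on coordinates from \<open>n\<close> on.\<close>
    moreover have "W = (\<Inter>j. \<Union>i\<in>{j..}. A (n + i))"
    proof -
      have "(\<Union>i\<in>{n + j..}. A i) = (\<Union>i\<in>{j..}. A (n + i))" for j
        by (simp only: image_add_atLeast[symmetric] image_image)
      moreover have "W = (\<Inter>j. \<Union>i\<in>{n + j..}. A i)"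
        unfolding W_def
      proof (intro equalityI INT_greatest)
        fix j
        have "(\<Inter>j. \<Union>i\<in>{n + j..}. A i) \<subseteq> (\<Union>i\<in>{n + j..}. A i)" by (rule INT_lower) simp
        also have "\<dots> \<subseteq> (\<Union>i\<in>{j..}. A i)" by (rule UN_mono) auto
        finally show "(\<Inter>j. \<Union>i\<in>{n + j..}. A i) \<subseteq> (\<Union>i\<in>{j..}. A i)" .
      qed (rule INT_lower, simp)
      ultimately show ?thesis by simp
    qed
    ultimately show "W \<in> sigma_sets (space ?S) (\<Union> (F ` {n..}))" by (simp add: N)
  qed
  then have "S.prob W = 0 \<or> S.prob W = 1" by (rule S.kolmogorov_0_1_law[OF F_sa indep])
  moreover have "S.prob E \<le> S.prob W"
  proof (rule LIMSEQ_le_const)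
    show "(\<lambda>j. S.prob (\<Union>i\<in>{j..}. A i)) \<longlonglongrightarrow> S.prob W"
      unfolding W_def by (rule S.finite_Lim_measure_decseq[OF _ dec]) auto
    have "S.prob E \<le> S.prob (\<Union>i\<in>{j..}. A i)" for j
      unfolding PA[of j, symmetric] by (rule S.finite_measure_mono) auto
    then show "\<exists>N. \<forall>n\<ge>N. S.prob E \<le> S.prob (\<Union>i\<in>{n..}. A i)" by blast
  qed
  ultimately have "S.prob W = 1" using E(2) by linarith
  then have "AE \<omega> in ?S. \<omega> \<in> W" using W_meas by (simp add: S.prob_eq_1)
  then show ?thesis by eventually_elim (auto simp: W_def A_def)
qed

end

section \<open>Positivity of the drift\<close>

locale isometric_random_walk = group G
  for G :: "('g, 'm) monoid_scheme" (structure) +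
  fixes \<mu> :: "'g measure" and \<phi> :: "'g \<Rightarrow> 'x \<Rightarrow> 'x::metric_space" and x0 :: 'x
  assumes countable_carrier: "countable (carrier G)"
    and \<mu>: "discrete_prob_on G \<mu>"
    and moment: "finite_first_moment \<phi> x0 \<mu>"
    and action: "group_action G UNIV \<phi>"
    and isometry: "\<And>g x y. g \<in> carrier G \<Longrightarrow> dist (\<phi> g x) (\<phi> g y) = dist x y"
begin

lemma action_mult: "\<lbrakk>g \<in> carrier G; h \<in> carrier G\<rbrakk> \<Longrightarrow> \<phi> (g \<otimes> h) x = \<phi> g (\<phi> h x)"
  using group_action.composition_rule[OF action] by simp

lemma action_one [simp]: "\<phi> \<one> x = x"
  using group_action.id_eq_one[OF action] by (metis UNIV_I restrict_apply')

lemma action_inv_left [simp]: "g \<in> carrier G \<Longrightarrow> \<phi> (inv g) (\<phi> g x) = x"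
  using action_mult[of "inv g" g x] by simp

lemma dist_action: "g \<in> carrier G \<Longrightarrow> dist x (\<phi> g y) = dist (\<phi> (inv g) x) y"
  using isometry[of "inv g" x "\<phi> g y"] by simp

lemma prob_\<mu>: "prob_space \<mu>" and sets_\<mu>: "sets \<mu> = Pow (carrier G)"
  using \<mu> by (auto simp: discrete_prob_on_def)

lemma space_\<mu>: "space \<mu> = carrier G"
  using sets_\<mu> by (metis sets_eq_imp_space_eq sets_count_space space_count_space)

sublocale P: prob_space "increments \<mu>"
  by (rule prob_space_increments[OF prob_\<mu>])

sublocale M: prob_space \<mu>
  by (rule prob_\<mu>)

lemma measurable_from_\<mu>: "f \<in> space \<mu> \<rightarrow> space N \<Longrightarrow> f \<in> measurable \<mu> N"
  by (auto simp: measurable_def sets_\<mu> space_\<mu>)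

lemma increment_closed: "\<omega> \<in> space (increments \<mu>) \<Longrightarrow> \<omega> i \<in> carrier G"
  by (simp add: space_increments space_\<mu>)

lemma drop_seq_space: "\<omega> \<in> space (increments \<mu>) \<Longrightarrow> drop_seq k \<omega> \<in> space (increments \<mu>)"
  by (simp add: space_increments drop_seq_def)

lemma walk_closed: "\<omega> \<in> space (increments \<mu>) \<Longrightarrow> walk G \<omega> n \<in> carrier G"
  by (induction n) (auto simp: increment_closed)

lemma walk_add: "\<omega> \<in> space (increments \<mu>) \<Longrightarrow>
    walk G \<omega> (m + n) = walk G \<omega> m \<otimes> walk G (drop_seq m \<omega>) n"
proof (induction n)
  case (Suc n)
  then show ?case
    using walk_closed drop_seq_space increment_closed
    by (simp add: m_assoc) (simp add: drop_seq_def add.commute)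
qed (simp add: walk_closed)

text \<open>Multiplication is treated one value of the first factor at a time, which countability of
  the group permits.\<close>

lemma measurable_walk: "(\<lambda>\<omega>. walk G \<omega> n) \<in> measurable (increments \<mu>) (count_space (carrier G))"
proof (induction n)
  case (Suc n)
  have "(\<lambda>\<omega>. (\<lambda>g. g \<otimes> \<omega> n) (walk G \<omega> n)) \<in> measurable (increments \<mu>) (count_space (carrier G))"
  proof (rule measurable_compose_countable'[OF _ Suc countable_carrier])
    fix g assume "g \<in> carrier G"
    then have "(\<lambda>h. g \<otimes> h) \<in> measurable \<mu> (count_space (carrier G))"
      by (intro measurable_from_\<mu>) (auto simp: space_\<mu>)
    then show "(\<lambda>\<omega>. g \<otimes> \<omega> n) \<in> measurable (increments \<mu>) (count_space (carrier G))"
      by (rule measurable_compose[OF measurable_coord[OF prob_\<mu>]])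
  qed
  then show ?case by simp
qed simp

lemma measurable_walk_fun [measurable]:
  "(\<lambda>\<omega>. (f (walk G \<omega> n) :: real)) \<in> borel_measurable (increments \<mu>)"
  by (rule measurable_compose[OF measurable_walk]) simp

definition displacement :: "nat \<Rightarrow> (nat \<Rightarrow> 'g) \<Rightarrow> real" where
  "displacement n \<omega> = dist (\<phi> (walk G \<omega> n) x0) x0"

lemma displacement_nonneg: "0 \<le> displacement n \<omega>"
  by (simp add: displacement_def)

lemma displacement_0 [simp]: "displacement 0 \<omega> = 0"
  by (simp add: displacement_def)

text \<open>Left invariance: the common initial segment of the two products cancels, so distances
  along a trajectory form a cocycle over the shift.\<close>

lemma dist_walk_walk:
  assumes "\<omega> \<in> space (increments \<mu>)" "k \<le> n"
  shows "dist (\<phi> (walk G \<omega> k) x0) (\<phi> (walk G \<omega> n) x0) = displacement (n - k) (drop_seq k \<omega>)"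
proof -
  have "\<phi> (walk G \<omega> n) x0 = \<phi> (walk G \<omega> k) (\<phi> (walk G (drop_seq k \<omega>) (n - k)) x0)"
    using walk_add[OF assms(1), of k "n - k"] assms walk_closed drop_seq_space
    by (simp add: action_mult)
  then show ?thesis
    using assms walk_closed by (simp add: isometry displacement_def dist_commute)
qed

lemma displacement_add:
  assumes "\<omega> \<in> space (increments \<mu>)"
  shows "displacement (m + n) \<omega> \<le> displacement m \<omega> + displacement n (drop_seq m \<omega>)"
  using dist_walk_walk[OF assms, of m "m + n"]
    dist_triangle[of "\<phi> (walk G \<omega> (m + n)) x0" x0 "\<phi> (walk G \<omega> m) x0"]
  by (simp add: displacement_def dist_commute)

lemma displacement_measurable [measurable]: "displacement n \<in> borel_measurable (increments \<mu>)"
  unfolding displacement_def[abs_def] by (rule measurable_walk_fun)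

lemma integrable_drop_seq:
  fixes f :: "(nat \<Rightarrow> 'g) \<Rightarrow> real"
  assumes "integrable (increments \<mu>) f"
  shows "integrable (increments \<mu>) (\<lambda>\<omega>. f (drop_seq k \<omega>))"
    "(\<integral>\<omega>. f (drop_seq k \<omega>) \<partial>increments \<mu>) = integral\<^sup>L (increments \<mu>) f"
  using assms integrable_distr_eq[of "drop_seq k" "increments \<mu>" "increments \<mu>" f]
    integral_distr[of "drop_seq k" "increments \<mu>" "increments \<mu>" f]
  by (auto simp: distr_drop_seq[OF prob_\<mu>] measurable_drop_seq[OF prob_\<mu>])

lemma displacement_integrable: "integrable (increments \<mu>) (displacement n)"
proof (induction n)
  case 0
  then show ?case by simp
next
  case (Suc n)
  have "integrable \<mu> (\<lambda>g. dist (\<phi> g x0) x0)"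
    using moment unfolding finite_first_moment_def
    by (intro integrableI_nonneg measurable_from_\<mu>) auto
  then have "integrable (distr (increments \<mu>) \<mu> (\<lambda>\<omega>. \<omega> 0)) (\<lambda>g. dist (\<phi> g x0) x0)"
    by (simp add: distr_coord[OF prob_\<mu>])
  then have "integrable (increments \<mu>) (\<lambda>\<omega>. dist (\<phi> (\<omega> 0) x0) x0)"
    by (subst (asm) integrable_distr_eq)
      (auto intro: measurable_coord[OF prob_\<mu>] measurable_from_\<mu>)
  moreover have "displacement 1 \<omega> = dist (\<phi> (\<omega> 0) x0) x0" if "\<omega> \<in> space (increments \<mu>)" for \<omega>
    using that increment_closed by (simp add: displacement_def)
  ultimately have 1: "integrable (increments \<mu>) (displacement 1)"
    by (subst Bochner_Integration.integrable_cong[OF refl]) auto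
  show ?case
  proof (rule Bochner_Integration.integrable_bound)
    show "integrable (increments \<mu>) (\<lambda>\<omega>. displacement 1 \<omega> + displacement n (drop_seq 1 \<omega>))"
      by (intro Bochner_Integration.integrable_add 1 integrable_drop_seq Suc)
    show "AE \<omega> in increments \<mu>. norm (displacement (Suc n) \<omega>)
        \<le> norm (displacement 1 \<omega> + displacement n (drop_seq 1 \<omega>))"
      using displacement_add[of _ 1 n] displacement_nonneg by (intro AE_I2) simp
  qed simp
qed

lemma mean_speed_eq: "mean_speed G \<phi> x0 \<mu> n = P.expectation (displacement n) / real n"
  by (simp add: mean_speed_def displacement_def[abs_def])

lemma mean_speed_limit:
  shows "mean_speed G \<phi> x0 \<mu> \<longlonglongrightarrow> drift G \<phi> x0 \<mu>"
    and "drift G \<phi> x0 \<mu> * real n \<le> P.expectation (displacement n)"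
proof -
  have "P.expectation (displacement (m + n))
      \<le> P.expectation (displacement m) + P.expectation (displacement n)" for m n
  proof -
    have "P.expectation (displacement (m + n))
      \<le> P.expectation (\<lambda>\<omega>. displacement m \<omega> + displacement n (drop_seq m \<omega>))"
      by (intro integral_mono Bochner_Integration.integrable_add displacement_integrable
          integrable_drop_seq displacement_add)
    then show ?thesis
      by (simp add: displacement_integrable integrable_drop_seq)
  qed
  moreover have "0 \<le> P.expectation (displacement n)" for n
    by (simp add: displacement_nonneg)
  ultimately obtain l where l: "(\<lambda>n. P.expectation (displacement n) / real n) \<longlonglongrightarrow> l"
    "\<And>n. l * real n \<le> P.expectation (displacement n)"
    using fekete[of "\<lambda>n. P.expectation (displacement n)"] by blast
  have lim: "mean_speed G \<phi> x0 \<mu> \<longlonglongrightarrow> l"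
    using l(1) by (simp add: mean_speed_eq[abs_def])
  then have "drift G \<phi> x0 \<mu> = l" unfolding drift_def by (rule limI)
  with lim l(2) show "mean_speed G \<phi> x0 \<mu> \<longlonglongrightarrow> drift G \<phi> x0 \<mu>"
    "drift G \<phi> x0 \<mu> * real n \<le> P.expectation (displacement n)" by auto
qed

lemma drift_nonneg: "0 \<le> drift G \<phi> x0 \<mu>"
  by (rule LIMSEQ_le_const[OF mean_speed_limit(1)])
    (auto simp: mean_speed_eq displacement_nonneg intro!: divide_nonneg_nonneg)

text \<open>The base point is left free because the recursion on the first increment moves
  it.\<close>

definition mean_dist :: "nat \<Rightarrow> 'x \<Rightarrow> real" where
  "mean_dist n x = P.expectation (\<lambda>\<omega>. dist x (\<phi> (walk G \<omega> n) x0))"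

lemma mean_dist_x0: "mean_dist n x0 = P.expectation (displacement n)"
  by (simp add: mean_dist_def displacement_def[abs_def] dist_commute)

lemma integrable_dist: "integrable (increments \<mu>) (\<lambda>\<omega>. dist x (\<phi> (walk G \<omega> n) x0))"
proof (rule Bochner_Integration.integrable_bound)
  show "integrable (increments \<mu>) (\<lambda>\<omega>. dist x x0 + displacement n \<omega>)"
    by (simp add: displacement_integrable)
  show "AE \<omega> in increments \<mu>. norm (dist x (\<phi> (walk G \<omega> n) x0)) \<le> norm (dist x x0 + displacement n \<omega>)"
  proof (rule AE_I2)
    fix \<omega>
    show "norm (dist x (\<phi> (walk G \<omega> n) x0)) \<le> norm (dist x x0 + displacement n \<omega>)"
      using dist_triangle[of x "\<phi> (walk G \<omega> n) x0" x0] displacement_nonneg[of n \<omega>]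
      by (simp add: displacement_def dist_commute[of x0])
  qed
qed simp

lemma walk_case_nat:
  assumes "s \<in> carrier G" "\<omega> \<in> space (increments \<mu>)"
  shows "walk G (case_nat s \<omega>) (Suc n) = s \<otimes> walk G \<omega> n"
proof -
  have "case_nat s \<omega> \<in> space (increments \<mu>)"
    using assms by (auto simp: space_increments space_\<mu> split: nat.split)
  moreover have "drop_seq 1 (case_nat s \<omega>) = \<omega>" by (simp add: drop_seq_def fun_eq_iff)
  ultimately show ?thesis using walk_add[of "case_nat s \<omega>" 1 n] assms by simp
qed

lemma mean_dist_Suc:
  shows "integrable \<mu> (\<lambda>g. mean_dist n (\<phi> (inv g) x))"
    and "mean_dist (Suc n) x = (\<integral>g. mean_dist n (\<phi> (inv g) x) \<partial>\<mu>)"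
proof -
  \<comment> \<open>Prepending an independent increment preserves the law of the sequence, so Fubini
    separates the first increment from the rest.\<close>
  interpret seq: sequence_space \<mu> by unfold_locales
  interpret pair: pair_prob_space \<mu> "increments \<mu>" by unfold_locales
  let ?J = "\<lambda>(s, \<omega>). case_nat s \<omega>"
  let ?F = "\<lambda>\<omega>. dist x (\<phi> (walk G \<omega> (Suc n)) x0)"
  have J: "distr (\<mu> \<Otimes>\<^sub>M increments \<mu>) (increments \<mu>) ?J = increments \<mu>"
    using seq.PiM_iter by (simp add: increments_def)
  have J_meas: "?J \<in> measurable (\<mu> \<Otimes>\<^sub>M increments \<mu>) (increments \<mu>)"
    unfolding increments_def by measurable
  have int: "integrable (\<mu> \<Otimes>\<^sub>M increments \<mu>) (\<lambda>p. ?F (?J p))"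
    using integrable_dist[of x "Suc n"] integrable_distr_eq[OF J_meas, of ?F] unfolding J by simp
  have inner: "(\<integral>\<omega>. ?F (?J (g, \<omega>)) \<partial>increments \<mu>) = mean_dist n (\<phi> (inv g) x)"
    if "g \<in> space \<mu>" for g
    unfolding mean_dist_def
    using that walk_closed
    by (intro Bochner_Integration.integral_cong refl)
      (simp add: walk_case_nat space_\<mu> action_mult dist_action del: walk.simps)
  show "integrable \<mu> (\<lambda>g. mean_dist n (\<phi> (inv g) x))"
    by (rule Bochner_Integration.integrable_cong[OF refl inner, THEN iffD1, OF _ pair.integrable_fst'[OF int]])
  have "mean_dist (Suc n) x = integral\<^sup>L (distr (\<mu> \<Otimes>\<^sub>M increments \<mu>) (increments \<mu>) ?J) ?F"
    unfolding J mean_dist_def ..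
  also have "\<dots> = integral\<^sup>L (\<mu> \<Otimes>\<^sub>M increments \<mu>) (\<lambda>p. ?F (?J p))"
    by (rule integral_distr[OF J_meas]) (rule measurable_walk_fun)
  also have "\<dots> = (\<integral>g. (\<integral>\<omega>. ?F (?J (g, \<omega>)) \<partial>increments \<mu>) \<partial>\<mu>)"
    by (rule pair.integral_fst'[OF int, symmetric])
  also have "\<dots> = (\<integral>g. mean_dist n (\<phi> (inv g) x) \<partial>\<mu>)"
    by (rule Bochner_Integration.integral_cong[OF refl inner])
  finally show "mean_dist (Suc n) x = (\<integral>g. mean_dist n (\<phi> (inv g) x) \<partial>\<mu>)" .
qed

text \<open>A consequence of \<open>s\<close> being charged by the \<open>k\<close>-fold convolution power of \<open>\<mu>\<close>, phrased so that
  convolutions can be avoided.\<close>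
definition reaches :: "nat \<Rightarrow> 'g \<Rightarrow> bool" where
  "reaches k s \<longleftrightarrow> (\<exists>p>0. \<forall>n c. (\<forall>y. c \<le> mean_dist n y) \<longrightarrow>
    (\<forall>x. c \<le> mean_dist (k + n) x \<and> p * (mean_dist n (\<phi> (inv s) x) - c) \<le> mean_dist (k + n) x - c))"

lemma reaches_0: "reaches 0 \<one>"
  unfolding reaches_def by (rule exI[of _ 1]) simp

text \<open>Because \<open>c\<close> is a lower bound everywhere, the integrand after subtracting
  \<open>c\<close> is nonnegative, and the atom at \<open>g\<close> alone bounds the
  integral.\<close>

lemma reaches_support:
  assumes g: "g \<in> carrier G" "0 < measure \<mu> {g}"
  shows "reaches 1 g"
  unfolding reaches_def
proof (intro exI[of _ "measure \<mu> {g}"] conjI allI impI)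
  fix n c x assume c: "\<forall>y. c \<le> mean_dist n y"
  have int: "integrable \<mu> (\<lambda>h. mean_dist n (\<phi> (inv h) x) - c)"
    by (intro Bochner_Integration.integrable_diff mean_dist_Suc(1)) simp
  have eq: "mean_dist (1 + n) x - c = (\<integral>h. mean_dist n (\<phi> (inv h) x) - c \<partial>\<mu>)"
    using mean_dist_Suc[of n x] by (simp add: M.prob_space)
  have "0 \<le> mean_dist (1 + n) x - c"
    unfolding eq using c by (intro Bochner_Integration.integral_nonneg) simp
  then show "c \<le> mean_dist (1 + n) x" by simp
  have "measure \<mu> {g} * (mean_dist n (\<phi> (inv g) x) - c)
      = (\<integral>h. indicator {g} h * (mean_dist n (\<phi> (inv g) x) - c) \<partial>\<mu>)"
    using g(1) by (simp add: sets_\<mu> space_\<mu> Int_absorb2)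
  also have "\<dots> \<le> (\<integral>h. mean_dist n (\<phi> (inv h) x) - c \<partial>\<mu>)"
  proof (rule integral_mono[OF _ int])
    show "integrable \<mu> (\<lambda>h. indicator {g} h * (mean_dist n (\<phi> (inv g) x) - c))"
      using g(1) by (intro integrable_mult_left integrable_real_indicator)
        (auto simp: sets_\<mu> M.emeasure_eq_measure)
  qed (use c in \<open>simp add: indicator_def\<close>)
  finally show "measure \<mu> {g} * (mean_dist n (\<phi> (inv g) x) - c) \<le> mean_dist (1 + n) x - c"
    unfolding eq .
qed (fact g(2))

text \<open>The two gains are chained at \<open>n\<close> and \<open>k + n\<close>. This is why
  \<open>reaches\<close> also asserts that the lower bound \<open>c\<close> persists: it is the
  hypothesis of the second application.\<close>

lemma reaches_mult:
  assumes "reaches j s" "reaches k t" "s \<in> carrier G" "t \<in> carrier G"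
  shows "reaches (j + k) (s \<otimes> t)"
proof -
  obtain p where p: "0 < p" "\<And>n c x. \<forall>y. c \<le> mean_dist n y \<Longrightarrow>
      c \<le> mean_dist (j + n) x \<and> p * (mean_dist n (\<phi> (inv s) x) - c) \<le> mean_dist (j + n) x - c"
    using assms(1) unfolding reaches_def by blast
  obtain q where q: "0 < q" "\<And>n c x. \<forall>y. c \<le> mean_dist n y \<Longrightarrow>
      c \<le> mean_dist (k + n) x \<and> q * (mean_dist n (\<phi> (inv t) x) - c) \<le> mean_dist (k + n) x - c"
    using assms(2) unfolding reaches_def by blast
  show ?thesis
    unfolding reaches_def
  proof (intro exI[of _ "p * q"] conjI allI impI)
    fix n c x assume c: "\<forall>y. c \<le> mean_dist n y"
    have kn: "\<forall>y. c \<le> mean_dist (k + n) y" using q(2)[OF c] by blast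
    show "c \<le> mean_dist (j + k + n) x" using p(2)[OF kn] by (simp add: add.assoc)
    have "p * (q * (mean_dist n (\<phi> (inv t) (\<phi> (inv s) x)) - c))
        \<le> p * (mean_dist (k + n) (\<phi> (inv s) x) - c)"
      using q(2)[OF c] p(1) by (intro mult_left_mono) auto
    also have "\<dots> \<le> mean_dist (j + (k + n)) x - c" using p(2)[OF kn] by blast
    finally show "p * q * (mean_dist n (\<phi> (inv (s \<otimes> t)) x) - c) \<le> mean_dist (j + k + n) x - c"
      using assms by (simp add: inv_mult_group action_mult add.assoc mult.assoc)
  qed (use p q in simp)
qed

lemma reaches_pow: "\<lbrakk>reaches k s; s \<in> carrier G\<rbrakk> \<Longrightarrow> reaches (n * k) (s [^] n)"
proof (induction n)
  case (Suc n)
  then have "reaches (n * k + k) (s [^] n \<otimes> s)" by (intro reaches_mult) auto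
  then show ?case by (simp add: add.commute)
qed (simp add: reaches_0)

lemma reaches_carrier:
  assumes adm: "admissible G \<mu>" and s: "s \<in> carrier G"
  obtains k where "1 \<le> k" "reaches k s"
proof -
  have "s \<in> carrier G \<and> (\<exists>k\<ge>1. reaches k s)"
    if "s \<in> generated_semigroup G {g \<in> carrier G. 0 < measure \<mu> {g}}" for s
    using that
  proof (induction rule: generated_semigroup.induct)
    case (incl g)
    then show ?case using reaches_support by blast
  next
    case (mult g h)
    then obtain j k where "1 \<le> j" "reaches j g" "reaches k h" by blast
    with mult reaches_mult[of j g k h] show ?case by (intro conjI exI[of _ "j + k"]) auto
  qed
  with s adm that show ?thesis unfolding admissible_def by blast
qed

text \<open>If \<open>c\<close> bounds \<open>mean_dist n\<close> below everywhere, averaging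
  \<open>spread\<close> over the endpoint of the walk shows that the four excesses over
  \<open>c\<close> sum to at least 1. Since \<open>reaches\<close> passes a positive fraction of
  each excess on, the lower bound rises by a fixed amount every \<open>L\<close> steps.\<close>

lemma drift_pos:
  assumes adm: "admissible G \<mu>" and g: "g \<in> carrier G" and h: "h \<in> carrier G"
    and spread: "\<And>N x y. N0 \<le> N \<Longrightarrow> 4 * dist x0 y + 1 \<le>
      dist (\<phi> (g [^] (N::nat)) x) y + dist (\<phi> (inv (g [^] N)) x) y +
      dist (\<phi> (h [^] N) x) y + dist (\<phi> (inv (h [^] N)) x) y"
  shows "0 < drift G \<phi> x0 \<mu>"
proof -
  obtain q where q: "1 \<le> q" "reaches q \<one>" using reaches_carrier[OF adm, of \<one>] by auto
  obtain k1 where k1: "1 \<le> k1" "reaches k1 g" using reaches_carrier[OF adm g] .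
  obtain k2 where k2: "1 \<le> k2" "reaches k2 (inv g)" using reaches_carrier[OF adm inv_closed[OF g]] .
  obtain k3 where k3: "1 \<le> k3" "reaches k3 h" using reaches_carrier[OF adm h] .
  obtain k4 where k4: "1 \<le> k4" "reaches k4 (inv h)" using reaches_carrier[OF adm inv_closed[OF h]] .
  define N where "N = q * Suc N0"
  define k where "k = k1 + k2 + k3 + k4"
  define L where "L = N * k"
  \<comment> \<open>\<open>N\<close> is a multiple of a period \<open>q\<close> of the identity, so the word lengths of the four elements
    can be equalized by padding with the identity.\<close>
  have N: "N0 \<le> N" "1 \<le> N" using q(1) by (cases q; auto simp: N_def)+
  have L: "1 \<le> L" using N k1 unfolding L_def k_def by (simp add: Suc_le_eq)
  have pad: "reaches L (s [^] N)" if s: "reaches i s" "s \<in> carrier G" "i \<le> k" for s i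
  proof -
    have "reaches (N * i + Suc N0 * (k - i) * q) (s [^] N \<otimes> \<one> [^] (Suc N0 * (k - i)))"
      using s q by (intro reaches_mult reaches_pow) auto
    moreover have "N * i + Suc N0 * (k - i) * q = N * i + N * (k - i)" by (simp only: N_def mult.commute mult.left_commute)
    moreover have "\<dots> = L" using s(3) by (simp add: L_def flip: distrib_left)
    ultimately show ?thesis using s by (simp del: mult_Suc)
  qed
  have "\<exists>p>0. \<forall>n c x. (\<forall>y. c \<le> mean_dist n y) \<longrightarrow>
     p * (mean_dist n (\<phi> (inv s) x) - c) \<le> mean_dist (L + n) x - c" if "reaches L s" for s
    using that unfolding reaches_def by blast
  then obtain p where p: "\<And>s. reaches L s \<Longrightarrow> 0 < p s"
    "\<And>s n c x. \<lbrakk>reaches L s; \<forall>y. c \<le> mean_dist n y\<rbrakk> \<Longrightarrow>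
      p s * (mean_dist n (\<phi> (inv s) x) - c) \<le> mean_dist (L + n) x - c" by metis
  \<comment> \<open>The set is closed under inversion, so the inverse occurring in
    \<open>reaches\<close> is harmless.\<close>
  define S where "S = {g [^] N, inv g [^] N, h [^] N, inv h [^] N}"
  have S: "reaches L s" if "s \<in> S" for s
    using that pad[of k1 g] pad[of k2 "inv g"] pad[of k3 h] pad[of k4 "inv h"] k1 k2 k3 k4 g h
    by (auto simp: S_def k_def)
  define \<alpha> where "\<alpha> = Min (p ` S)"
  have fin: "finite S" "S \<noteq> {}" by (auto simp: S_def)
  have \<alpha>: "0 < \<alpha>" "\<And>s. s \<in> S \<Longrightarrow> \<alpha> \<le> p s"
    using fin p(1) S by (auto simp: \<alpha>_def Min_gr_iff)
  have grow: "c + \<alpha> / 4 \<le> mean_dist (L + n) x" if c: "\<forall>y. c \<le> mean_dist n y" for n c x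
  proof -
    have le: "\<alpha> * (mean_dist n (\<phi> (inv s) x) - c) \<le> mean_dist (L + n) x - c" if "s \<in> S" for s
    proof -
      have "\<alpha> * (mean_dist n (\<phi> (inv s) x) - c) \<le> p s * (mean_dist n (\<phi> (inv s) x) - c)"
        using \<alpha>(2)[OF that] c by (intro mult_right_mono) auto
      also have "\<dots> \<le> mean_dist (L + n) x - c" by (rule p(2)[OF S[OF that] c])
      finally show ?thesis .
    qed
    let ?m = "\<lambda>s. mean_dist n (\<phi> s x)"
    have inv_pow: "inv (g [^] N) = inv g [^] N" "inv (h [^] N) = inv h [^] N"
      using g h by (simp_all add: nat_pow_inv)
    have "4 * mean_dist n x0 + 1 = P.expectation (\<lambda>\<omega>. 4 * dist x0 (\<phi> (walk G \<omega> n) x0) + 1)"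
      by (simp add: mean_dist_def integrable_dist P.prob_space)
    also have "\<dots> \<le> P.expectation (\<lambda>\<omega>.
        dist (\<phi> (g [^] N) x) (\<phi> (walk G \<omega> n) x0) + dist (\<phi> (inv (g [^] N)) x) (\<phi> (walk G \<omega> n) x0) +
        dist (\<phi> (h [^] N) x) (\<phi> (walk G \<omega> n) x0) + dist (\<phi> (inv (h [^] N)) x) (\<phi> (walk G \<omega> n) x0))"
      by (intro integral_mono spread N) (simp_all add: integrable_dist)
    also have "\<dots> = ?m (g [^] N) + ?m (inv (g [^] N)) + ?m (h [^] N) + ?m (inv (h [^] N))"
      by (simp add: mean_dist_def integrable_dist)
    finally have sum: "4 * mean_dist n x0 + 1
      \<le> ?m (g [^] N) + ?m (inv (g [^] N)) + ?m (h [^] N) + ?m (inv (h [^] N))" .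
    have "\<alpha> * 1 \<le> \<alpha> * (?m (g [^] N) + ?m (inv (g [^] N)) + ?m (h [^] N) + ?m (inv (h [^] N)) - 4 * c)"
      using sum c[rule_format, of x0] \<alpha>(1) by (intro mult_left_mono) auto
    also have "\<dots> = \<alpha> * (?m (g [^] N) - c) + \<alpha> * (?m (inv (g [^] N)) - c)
        + \<alpha> * (?m (h [^] N) - c) + \<alpha> * (?m (inv (h [^] N)) - c)"
      by (simp add: algebra_simps)
    also have "\<dots> \<le> 4 * (mean_dist (L + n) x - c)"
      using le[of "inv g [^] N"] le[of "g [^] N"] le[of "inv h [^] N"] le[of "h [^] N"] g h
      unfolding S_def inv_pow[symmetric] by simp
    finally show ?thesis by simp
  qed
  have "real n * (\<alpha> / 4) \<le> mean_dist (n * L) x" for n x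
  proof (induction n arbitrary: x)
    case 0
    then show ?case by (simp add: mean_dist_def)
  next
    case (Suc n)
    then have "real n * (\<alpha> / 4) + \<alpha> / 4 \<le> mean_dist (L + n * L) x" by (intro grow) simp
    then show ?case by (simp add: algebra_simps)
  qed
  then have lower: "real n * (\<alpha> / 4) \<le> P.expectation (displacement (n * L))" for n
    by (simp flip: mean_dist_x0)
  \<comment> \<open>The limit defining the drift exists, so multiples of \<open>L\<close> determine
    it.\<close>
  have "strict_mono (\<lambda>n. n * L)" using L by (intro strict_monoI) simp
  from LIMSEQ_subseq_LIMSEQ[OF mean_speed_limit(1) this]
  have "(\<lambda>n. mean_speed G \<phi> x0 \<mu> (n * L)) \<longlonglongrightarrow> drift G \<phi> x0 \<mu>" by (simp add: comp_def)
  moreover have "\<alpha> / 4 / real L \<le> mean_speed G \<phi> x0 \<mu> (n * L)" if "1 \<le> n" for n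
    using lower[of n] that L by (simp add: mean_speed_eq field_simps)
  ultimately have "\<alpha> / 4 / real L \<le> drift G \<phi> x0 \<mu>"
    by (intro LIMSEQ_le_const) blast+
  moreover have "0 < \<alpha> / 4 / real L" using \<alpha>(1) L by simp
  ultimately show ?thesis by linarith
qed

end

section \<open>Almost sure estimates\<close>

context isometric_random_walk
begin

lemma funpow_drop_seq_1: "(drop_seq 1 ^^ k) \<omega> = drop_seq k \<omega>"
  by (simp add: funpow_drop_seq)

text \<open>One half of \<epsilon> makes the mean of the cocycle \<open>b\<close> grow linearly; the
  other half pays for replacing the random starting time \<open>i\<close>, from which the leaders
  are obtained, by time 0.\<close>

lemma AE_straight_times:
  assumes \<epsilon>: "0 < \<epsilon>"
  shows "AE \<omega> in increments \<mu>. \<exists>K. \<exists>\<^sub>\<infinity>n.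
    straight_time (\<lambda>k. \<phi> (walk G \<omega> k) x0) (drift G \<phi> x0 \<mu>) \<epsilon> K n"
proof -
  define B where "B = drift G \<phi> x0 \<mu> - \<epsilon> / 2"
  define b where "b n \<omega> = displacement n \<omega> - B * real n" for n \<omega>
  define E where "E = {\<omega> \<in> space (increments \<mu>).
    \<exists>\<^sub>\<infinity>n. \<forall>k\<le>n. b (n - k) ((drop_seq 1 ^^ k) \<omega>) \<le> b n \<omega>}"
  have E: "E \<in> sets (increments \<mu>)" "0 < measure (increments \<mu>) E"
  proof -
    have 1: "drop_seq 1 \<in> measurable (increments \<mu>) (increments \<mu>)"
      and 2: "distr (increments \<mu>) (increments \<mu>) (drop_seq 1) = increments \<mu>"
      using measurable_drop_seq distr_drop_seq prob_\<mu> by auto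
    have 3: "integrable (increments \<mu>) (b n)" for n
      unfolding b_def[abs_def] by (simp add: displacement_integrable)
    have 4: "b 0 \<omega> = 0" for \<omega> by (simp add: b_def)
    have 5: "b (Suc n) \<omega> \<le> b 1 \<omega> + b n (drop_seq 1 \<omega>)" if "\<omega> \<in> space (increments \<mu>)" for n \<omega>
      using displacement_add[OF that, of 1 n] by (simp add: b_def algebra_simps)
    have 6: "\<epsilon> / 2 * real n \<le> P.expectation (b n)" for n
      using mean_speed_limit(2)[of n] unfolding b_def[abs_def]
      by (simp add: displacement_integrable P.prob_space B_def algebra_simps)
    have 7: "0 < \<epsilon> / 2" using \<epsilon> by simp
    show "E \<in> sets (increments \<mu>)" "0 < measure (increments \<mu>) E"
      unfolding E_def by (rule P.prob_recurrent_maxima_pos[OF 1 2 3 4 5 7 6]; assumption)+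
  qed
  have "AE \<omega> in increments \<mu>. \<exists>i. drop_seq i \<omega> \<in> E"
    by (rule AE_drop_seq_hits[OF prob_\<mu> E]) simp
  then show ?thesis
  proof (rule AE_mp, intro AE_I2 impI)
    fix \<omega> assume \<omega>: "\<omega> \<in> space (increments \<mu>)" and "\<exists>i. drop_seq i \<omega> \<in> E"
    then obtain i where i: "drop_seq i \<omega> \<in> E" by blast
    \<comment> \<open>The whole cost of moving the start from time \<open>i\<close> to time 0; for
      \<open>k\<close> beyond \<open>K1\<close> it is at most
      \<open>\<epsilon> / 2 * real k\<close>.\<close>
    define C where "C = displacement i \<omega> + B * real i"
    obtain K1 where K1: "2 * C / \<epsilon> \<le> real K1" using real_arch_simple by blast
    have straight: "straight_time (\<lambda>k. \<phi> (walk G \<omega> k) x0) (drift G \<phi> x0 \<mu>) \<epsilon> (i + K1) (i + n)"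
      if n: "\<forall>k\<le>n. b (n - k) ((drop_seq 1 ^^ k) (drop_seq i \<omega>)) \<le> b n (drop_seq i \<omega>)" for n
      unfolding straight_time_def
    proof (intro allI impI)
      fix k assume k: "i + K1 \<le> k" "k \<le> i + n"
      have "b (n - (k - i)) (drop_seq k \<omega>) \<le> b n (drop_seq i \<omega>)"
        using n[rule_format, of "k - i"] k unfolding funpow_drop_seq_1 by simp
      then have 1: "displacement (i + n - k) (drop_seq k \<omega>)
          \<le> displacement n (drop_seq i \<omega>) - B * (real k - real i)"
        using k by (simp add: b_def of_nat_diff algebra_simps)
      have "dist (\<phi> (walk G \<omega> i) x0) (\<phi> (walk G \<omega> (i + n)) x0)
          \<le> displacement i \<omega> + displacement (i + n) \<omega>"
        unfolding displacement_def by (rule dist_triangle2)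
      then have 2: "displacement n (drop_seq i \<omega>) \<le> displacement i \<omega> + displacement (i + n) \<omega>"
        using dist_walk_walk[OF \<omega>, of i "i + n"] by simp
      have "C \<le> \<epsilon> / 2 * real K1" using K1 \<epsilon> by (simp add: field_simps)
      also have "\<dots> \<le> \<epsilon> / 2 * real k" using k \<epsilon> by (intro mult_left_mono) auto
      finally have 3: "C \<le> \<epsilon> / 2 * real k" .
      have "displacement (i + n - k) (drop_seq k \<omega>)
          \<le> displacement (i + n) \<omega> - (drift G \<phi> x0 \<mu> - \<epsilon>) * real k"
      proof -
        have "B * (real k - real i) = B * real k - B * real i"
          "(drift G \<phi> x0 \<mu> - \<epsilon>) * real k = B * real k - \<epsilon> / 2 * real k"
          unfolding B_def by (simp_all add: field_simps)
        with 1 2 3 show ?thesis unfolding C_def by linarith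
      qed
      then show "dist (\<phi> (walk G \<omega> k) x0) (\<phi> (walk G \<omega> (i + n)) x0)
        \<le> dist (\<phi> (walk G \<omega> 0) x0) (\<phi> (walk G \<omega> (i + n)) x0) - (drift G \<phi> x0 \<mu> - \<epsilon>) * real k"
        using dist_walk_walk[OF \<omega> k(2)] by (simp add: displacement_def dist_commute)
    qed
    have inf: "\<exists>\<^sub>\<infinity>n. \<forall>k\<le>n. b (n - k) ((drop_seq 1 ^^ k) (drop_seq i \<omega>)) \<le> b n (drop_seq i \<omega>)"
      using i by (simp add: E_def)
    have "\<exists>\<^sub>\<infinity>n. straight_time (\<lambda>k. \<phi> (walk G \<omega> k) x0) (drift G \<phi> x0 \<mu>) \<epsilon> (i + K1) n"
      unfolding INFM_nat
    proof
      fix m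
      obtain n where "m < n" "\<forall>k\<le>n. b (n - k) ((drop_seq 1 ^^ k) (drop_seq i \<omega>)) \<le> b n (drop_seq i \<omega>)"
        using inf unfolding INFM_nat by blast
      then show "\<exists>n>m. straight_time (\<lambda>k. \<phi> (walk G \<omega> k) x0) (drift G \<phi> x0 \<mu>) \<epsilon> (i + K1) n"
        using straight by (intro exI[of _ "i + n"]) auto
    qed
    then show "\<exists>K. \<exists>\<^sub>\<infinity>n. straight_time (\<lambda>k. \<phi> (walk G \<omega> k) x0) (drift G \<phi> x0 \<mu>) \<epsilon> K n" ..
  qed
qed

lemma displacement_sum:
  assumes "\<omega> \<in> space (increments \<mu>)"
  shows "displacement (k * N) \<omega> \<le> (\<Sum>i<k. displacement N (drop_seq (i * N) \<omega>))"
proof (induction k)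
  case (Suc k)
  then show ?case using displacement_add[OF assms, of "k * N" N] by (simp add: add.commute)
qed simp

text \<open>A one-sided law of large numbers. Displacement is bounded by a sum over blocks of a
  length \<open>N\<close> whose mean speed is nearly the drift; the deficit \<open>f\<close> of a
  block has positive mean, and the leader argument applies to its sums along shifts by
  \<open>N\<close>.\<close>

lemma AE_displacement_upper:
  assumes \<epsilon>: "0 < \<epsilon>"
  shows "AE \<omega> in increments \<mu>. \<forall>\<^sub>F n in sequentially.
    displacement n \<omega> \<le> (drift G \<phi> x0 \<mu> + \<epsilon>) * real n"
proof -
  define A where "A = drift G \<phi> x0 \<mu>"
  have "\<forall>\<^sub>F n in sequentially. mean_speed G \<phi> x0 \<mu> n < A + \<epsilon> / 4"
    using mean_speed_limit(1) \<epsilon> unfolding A_def by (intro order_tendstoD(2)) auto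
  then have "\<forall>\<^sub>F n in sequentially. mean_speed G \<phi> x0 \<mu> n < A + \<epsilon> / 4 \<and> 1 \<le> n"
    using eventually_ge_at_top by (rule eventually_conj)
  then obtain N where N: "mean_speed G \<phi> x0 \<mu> N < A + \<epsilon> / 4" "1 \<le> N"
    using eventually_happens' sequentially_bot by blast
  define f where "f \<omega> = (A + \<epsilon> / 2) * real N - displacement N \<omega>" for \<omega>
  define b where "b n \<omega> = (\<Sum>i<n. f (drop_seq (i * N) \<omega>))" for n \<omega>
  define E where "E = {\<omega> \<in> space (increments \<mu>).
    \<exists>\<^sub>\<infinity>n. \<forall>k\<le>n. b (n - k) ((drop_seq N ^^ k) \<omega>) \<le> b n \<omega>}"
  have f_int: "integrable (increments \<mu>) f"
    unfolding f_def[abs_def] by (simp add: displacement_integrable)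
  have b_add: "b (m + n) \<omega> = b m \<omega> + b n (drop_seq (m * N) \<omega>)" for m n \<omega>
    by (induction n) (simp_all add: b_def algebra_simps)
  have E: "E \<in> sets (increments \<mu>)" "0 < measure (increments \<mu>) E"
  proof -
    have 1: "drop_seq N \<in> measurable (increments \<mu>) (increments \<mu>)"
      and 2: "distr (increments \<mu>) (increments \<mu>) (drop_seq N) = increments \<mu>"
      using measurable_drop_seq distr_drop_seq prob_\<mu> by auto
    have 3: "integrable (increments \<mu>) (b n)" for n
      unfolding b_def[abs_def] by (intro Bochner_Integration.integrable_sum integrable_drop_seq f_int)
    have 4: "b 0 \<omega> = 0" for \<omega> by (simp add: b_def)
    have 5: "b (Suc n) \<omega> \<le> b 1 \<omega> + b n (drop_seq N \<omega>)" for n \<omega>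
      using b_add[of 1 n \<omega>] by simp
    have 6: "\<epsilon> / 4 * real N * real n \<le> P.expectation (b n)" for n
    proof -
      have "P.expectation (b n) = real n * P.expectation f"
        unfolding b_def[abs_def] using integrable_drop_seq[OF f_int]
        by (simp add: Bochner_Integration.integral_sum)
      also have "P.expectation f = (A + \<epsilon> / 2) * real N - P.expectation (displacement N)"
        unfolding f_def[abs_def] by (simp add: displacement_integrable P.prob_space)
      finally have eq: "P.expectation (b n) = real n * ((A + \<epsilon> / 2) * real N - P.expectation (displacement N))" .
      have "P.expectation (displacement N) \<le> (A + \<epsilon> / 4) * real N"
        using N by (simp add: mean_speed_eq field_simps)
      then have "real n * (\<epsilon> / 4 * real N) \<le> real n * ((A + \<epsilon> / 2) * real N - P.expectation (displacement N))"
        by (intro mult_left_mono) (simp_all add: algebra_simps)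
      with eq show ?thesis by (simp add: mult_ac)
    qed
    have 7: "0 < \<epsilon> / 4 * real N" using \<epsilon> N by simp
    show "E \<in> sets (increments \<mu>)" "0 < measure (increments \<mu>) E"
      unfolding E_def by (rule P.prob_recurrent_maxima_pos[OF 1 2 3 4 5 7 6])+
  qed
  \<comment> \<open>For the additive \<open>b\<close> a dominating time is one from which no initial
    sum is negative; having infinitely many of them covers every \<open>k\<close>.\<close>
  have b_nonneg: "0 \<le> b k \<omega>" if "\<omega> \<in> E" for k \<omega>
  proof -
    have inf: "\<exists>\<^sub>\<infinity>n. \<forall>k\<le>n. b (n - k) ((drop_seq N ^^ k) \<omega>) \<le> b n \<omega>"
      using that by (simp add: E_def)
    then obtain n where "k < n" "\<forall>k\<le>n. b (n - k) ((drop_seq N ^^ k) \<omega>) \<le> b n \<omega>"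
      unfolding INFM_nat by blast
    then have "b (n - k) (drop_seq (k * N) \<omega>) \<le> b n \<omega>" by (simp add: funpow_drop_seq)
    with b_add[of k "n - k" \<omega>] \<open>k < n\<close> show ?thesis by simp
  qed
  \<comment> \<open>Block sums only control times in one residue class modulo \<open>N\<close>, so a
    good starting time \<open>j r\<close> is needed in every class; any late \<open>n\<close> is
    then \<open>j r + k * N\<close> with \<open>r = n mod N\<close>.\<close>
  have "AE \<omega> in increments \<mu>. \<forall>r. \<exists>i. drop_seq (r + i * N) \<omega> \<in> E"
    unfolding AE_all_countable
  proof
    fix r show "AE \<omega> in increments \<mu>. \<exists>i. drop_seq (r + i * N) \<omega> \<in> E"
      by (rule AE_drop_seq_hits[OF prob_\<mu> E]) (use N(2) in \<open>simp add: trans_le_add2\<close>)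
  qed
  then show ?thesis
  proof (rule AE_mp, intro AE_I2 impI)
    fix \<omega> assume \<omega>: "\<omega> \<in> space (increments \<mu>)" and "\<forall>r. \<exists>i. drop_seq (r + i * N) \<omega> \<in> E"
    then obtain i where i: "\<And>r. drop_seq (r + i r * N) \<omega> \<in> E" by metis
    define j where "j r = r + i r * N" for r
    have up: "displacement (j r + k * N) \<omega> \<le> displacement (j r) \<omega> + (A + \<epsilon> / 2) * real (k * N)" for r k
    proof -
      have "0 \<le> b k (drop_seq (j r) \<omega>)" using b_nonneg i unfolding j_def by blast
      then have "(\<Sum>i<k. displacement N (drop_seq (i * N) (drop_seq (j r) \<omega>))) \<le> (A + \<epsilon> / 2) * real (k * N)"
        by (simp add: b_def f_def sum_subtractf algebra_simps)
      with displacement_sum[OF drop_seq_space[OF \<omega>], of k N "j r"]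
        displacement_add[OF \<omega>, of "j r" "k * N"]
      show ?thesis by linarith
    qed
    define m where "m = (\<Sum>r<N. j r)"
    define C where "C = (\<Sum>r<N. displacement (j r) \<omega>)"
    have m: "j r \<le> m" and C: "displacement (j r) \<omega> \<le> C" if "r < N" for r
      using that unfolding m_def C_def
      by (auto intro!: member_le_sum displacement_nonneg)
    obtain M where M: "2 * C / \<epsilon> \<le> real M" using real_arch_simple by blast
    have "displacement n \<omega> \<le> (A + \<epsilon>) * real n" if n: "m + M \<le> n" for n
    proof -
      define r where "r = n mod N"
      have r: "r < N" using N by (simp add: r_def)
      have jn: "j r \<le> n" using m[OF r] n by simp
      have "(n - j r) mod N = 0"
        using jn by (simp add: j_def r_def mod_eq_0_iff_dvd)
          (metis dvd_diff_nat dvd_minus_mod dvd_triv_right diff_diff_left)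
      then obtain k where k: "n = j r + k * N" using jn
        by (metis add_diff_cancel_left' le_Suc_ex mod_0_imp_dvd dvd_div_mult_self)
      have "C \<le> \<epsilon> / 2 * real M" using M \<epsilon> by (simp add: field_simps)
      also have "\<dots> \<le> \<epsilon> / 2 * real n" using n \<epsilon> by (intro mult_left_mono) auto
      finally have Cn: "C \<le> \<epsilon> / 2 * real n" .
      have "displacement n \<omega> \<le> C + (A + \<epsilon> / 2) * real (k * N)"
        using up[of r k] C[OF r] k by simp
      also have "\<dots> \<le> C + (A + \<epsilon> / 2) * real n"
        using k drift_nonneg \<epsilon> by (intro add_left_mono mult_left_mono) (auto simp: A_def)
      finally show ?thesis using Cn by (simp add: algebra_simps)
    qed
    then show "\<forall>\<^sub>F n in sequentially. displacement n \<omega> \<le> (drift G \<phi> x0 \<mu> + \<epsilon>) * real n"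
      unfolding eventually_sequentially A_def by blast
  qed
qed

end

section \<open>From independent contracting elements to the tracking theorem\<close>

context isometric_random_walk
begin

lemma translates_int_pow:
  assumes g: "g \<in> carrier G" and tr: "\<And>t. \<phi> g (c t) = c (t + a)"
  shows "translates (\<phi> (g [^] (m::int))) c (of_int m * a)"
proof -
  have nat: "\<phi> (g [^] n) (c t) = c (t + real n * a)" for n :: nat and t
    by (induction n arbitrary: t) (use g tr in \<open>simp_all add: action_mult algebra_simps\<close>)
  have "\<phi> (g [^] m) (c t) = c (t + of_int m * a)" for t
  proof (cases m)
    case (nonneg n)
    then show ?thesis using nat by (simp add: int_pow_int)
  next
    case (neg n)
    have "c t = \<phi> (g [^] Suc n) (c (t - real (Suc n) * a))" using nat[of "Suc n"] by simp
    then have "\<phi> (inv (g [^] Suc n)) (c t) = c (t - real (Suc n) * a)"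
      using g by (metis action_inv_left nat_pow_closed)
    then show ?thesis using g neg by (simp add: int_pow_neg_int del: of_nat_Suc)
  qed
  then show ?thesis using g by (auto simp: translates_def isometry)
qed

text \<open>Properness makes the preimage of a compact interval compact, and compact subsets of a
  discrete space are finite.\<close>

lemma independent_elements_finite:
  assumes "independent_elements G \<phi> x0 g h"
  shows "finite {(m::int, n::int). dist (\<phi> (g [^] m) x0) (\<phi> (h [^] n) x0) \<le> r}"
proof -
  let ?f = "\<lambda>(m::int, n::int). dist (\<phi> (g [^] m) x0) (\<phi> (h [^] n) x0)"
  have "compactin (top_of_set {0..}) {0..max r 0}"
    by (auto simp: compactin_subtopology)
  then have "compactin (discrete_topology UNIV) {p \<in> topspace (discrete_topology UNIV). ?f p \<in> {0..max r 0}}"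
    using assms unfolding independent_elements_def by (rule compactin_proper_map_preimage[rotated])
  then have "finite {p. ?f p \<in> {0..max r 0}}" by (simp add: compactin_discrete_topology)
  then show ?thesis by (rule rev_finite_subset) auto
qed

lemma independent_contracting_spread:
  assumes X: "CAT0 TYPE('x)" and g: "g \<in> carrier G" and h: "h \<in> carrier G"
    and cg: "contracting_isometry (\<phi> g)" and ch: "contracting_isometry (\<phi> h)"
    and ind: "independent_elements G \<phi> x0 g h"
  shows "\<exists>N0. \<forall>N\<ge>N0. \<forall>x y. 4 * dist x0 y + 1 \<le>
      dist (\<phi> (g [^] (N::nat)) x) y + dist (\<phi> (inv (g [^] N)) x) y +
      dist (\<phi> (h [^] N) x) y + dist (\<phi> (inv (h [^] N)) x) y"
proof -
  obtain c1 C1 a1 where 1: "geodesic_on UNIV c1" "a1 \<noteq> 0" "\<And>t. \<phi> g (c1 t) = c1 (t + a1)"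
    "0 < C1" "contracting_set C1 (range c1)"
    using cg unfolding contracting_isometry_def axis_of_def by blast
  obtain c2 C2 a2 where 2: "geodesic_on UNIV c2" "a2 \<noteq> 0" "\<And>t. \<phi> h (c2 t) = c2 (t + a2)"
    "0 < C2" "contracting_set C2 (range c2)"
    using ch unfolding contracting_isometry_def axis_of_def by blast
  interpret two_contracting_lines c1 c2 C1 C2 x0
    by unfold_locales (use X 1 2 in auto)
  note tg = translates_int_pow[of g c1 a1, OF g 1(3)]
    and th = translates_int_pow[of h c2 a2, OF h 2(3)]
  obtain R where R: "\<And>x. \<bar>L1.foot x - L1.foot x0\<bar> \<le> R \<or> \<bar>L2.foot x - L2.foot x0\<bar> \<le> R"
    using bounded_projections[OF 1(2) 2(2) tg th independent_elements_finite[OF ind]] by blast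
  obtain T0 where T0: "\<And>T1 T2 f1 f1' f2 f2' x y. \<lbrakk>T0 \<le> \<bar>T1\<bar>; T0 \<le> \<bar>T2\<bar>;
      translates f1 c1 T1; translates f1' c1 (- T1); translates f2 c2 T2; translates f2' c2 (- T2)\<rbrakk>
    \<Longrightarrow> 4 * dist x0 y + 1 \<le> dist (f1 x) y + dist (f1' x) y + dist (f2 x) y + dist (f2' x) y"
    using four_translates[OF R] by metis
  obtain N1 where N1: "T0 / \<bar>a1\<bar> \<le> real N1" using real_arch_simple by blast
  obtain N2 where N2: "T0 / \<bar>a2\<bar> \<le> real N2" using real_arch_simple by blast
  have "4 * dist x0 y + 1 \<le> dist (\<phi> (g [^] N) x) y + dist (\<phi> (inv (g [^] N)) x) y +
      dist (\<phi> (h [^] N) x) y + dist (\<phi> (inv (h [^] N)) x) y" if N: "max N1 N2 \<le> N" for N x y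
  proof (rule T0[of "real N * a1" "real N * a2" "\<phi> (g [^] N)" "\<phi> (inv (g [^] N))"
        "\<phi> (h [^] N)" "\<phi> (inv (h [^] N))"])
    have "T0 / \<bar>a1\<bar> \<le> real N" "T0 / \<bar>a2\<bar> \<le> real N" using N N1 N2 by auto
    then show "T0 \<le> \<bar>real N * a1\<bar>" "T0 \<le> \<bar>real N * a2\<bar>"
      using 1(2) 2(2) by (auto simp: abs_mult pos_divide_le_eq)
    show "translates (\<phi> (g [^] N)) c1 (real N * a1)" "translates (\<phi> (h [^] N)) c2 (real N * a2)"
      using tg[of "int N"] th[of "int N"] by (simp_all add: int_pow_int)
    show "translates (\<phi> (inv (g [^] N))) c1 (- (real N * a1))"
      "translates (\<phi> (inv (h [^] N))) c2 (- (real N * a2))"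
      using tg[of "- int N"] th[of "- int N"] g h by (simp_all add: int_pow_neg_int)
  qed
  then show ?thesis by blast
qed

end

lemma straight_time_mono:
  assumes "straight_time z A \<epsilon> K n" "\<epsilon> \<le> \<delta>"
  shows "straight_time z A \<delta> K n"
  unfolding straight_time_def
proof (intro allI impI)
  fix k assume "K \<le> k" "k \<le> n"
  then have "dist (z k) (z n) \<le> dist (z 0) (z n) - (A - \<epsilon>) * real k"
    using assms(1) by (simp add: straight_time_def)
  moreover have "(A - \<delta>) * real k \<le> (A - \<epsilon>) * real k"
    using assms(2) by (intro mult_right_mono) auto
  ultimately show "dist (z k) (z n) \<le> dist (z 0) (z n) - (A - \<delta>) * real k" by linarith
qed

text \<open>The exceptional null set depends on \<epsilon>; taking \<epsilon> of the form
  \<open>1 / real (Suc i)\<close> leaves countably many, and monotonicity in \<epsilon> recovers all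
  positive values.\<close>

lemma AE_ray_tracking:
  fixes \<phi> :: "'g \<Rightarrow> 'x \<Rightarrow> 'x::complete_space"
  assumes "isometric_random_walk G \<mu> \<phi> x0"
    and X: "CAT0 TYPE('x)" and A: "0 < drift G \<phi> x0 \<mu>"
  shows "AE \<omega> in increments \<mu>. \<exists>\<gamma>. geodesic_on {0..} \<gamma> \<and> \<gamma> 0 = x0 \<and>
    (\<lambda>n. (1 / real n) * dist (\<gamma> (drift G \<phi> x0 \<mu> * real n)) (\<phi> (walk G \<omega> n) x0)) \<longlonglongrightarrow> 0"
proof -
  interpret isometric_random_walk G \<mu> \<phi> x0 by fact
  let ?\<epsilon> = "\<lambda>i. 1 / real (Suc i)"
  have "AE \<omega> in increments \<mu>. \<forall>i. \<exists>K. \<exists>\<^sub>\<infinity>n.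
      straight_time (\<lambda>k. \<phi> (walk G \<omega> k) x0) (drift G \<phi> x0 \<mu>) (?\<epsilon> i) K n"
    unfolding AE_all_countable by (intro allI AE_straight_times) simp
  moreover have "AE \<omega> in increments \<mu>. \<forall>i. \<forall>\<^sub>F n in sequentially.
      displacement n \<omega> \<le> (drift G \<phi> x0 \<mu> + ?\<epsilon> i) * real n"
    unfolding AE_all_countable by (intro allI AE_displacement_upper) simp
  ultimately show ?thesis
  proof eventually_elim
    case (elim \<omega>)
    define z where "z k = \<phi> (walk G \<omega> k) x0" for k
    have z0: "z 0 = x0" by (simp add: z_def)
    have "\<exists>\<gamma>. geodesic_on {0..} \<gamma> \<and> \<gamma> 0 = z 0 \<and>
        (\<lambda>n. 1 / real n * dist (\<gamma> (drift G \<phi> x0 \<mu> * real n)) (z n)) \<longlonglongrightarrow> 0"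
    proof (rule CAT0_ray_tracking[OF X A])
      fix \<epsilon> :: real assume "0 < \<epsilon>"
      then obtain i where i: "?\<epsilon> i < \<epsilon>" using nat_approx_posE by blast
      obtain K where "\<exists>\<^sub>\<infinity>n. straight_time z (drift G \<phi> x0 \<mu>) (?\<epsilon> i) K n"
        using elim(1) unfolding z_def by blast
      then have "\<exists>\<^sub>\<infinity>n. straight_time z (drift G \<phi> x0 \<mu>) \<epsilon> K n"
        by (rule INFM_mono) (rule straight_time_mono, use i in auto)
      then show "\<exists>K. \<exists>\<^sub>\<infinity>n. straight_time z (drift G \<phi> x0 \<mu>) \<epsilon> K n" ..
      have "\<forall>\<^sub>F n in sequentially. displacement n \<omega> \<le> (drift G \<phi> x0 \<mu> + ?\<epsilon> i) * real n"
        using elim(2) by blast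
      then show "\<forall>\<^sub>F k in sequentially. dist (z 0) (z k) \<le> (drift G \<phi> x0 \<mu> + \<epsilon>) * real k"
      proof eventually_elim
        case (elim n)
        also have "(drift G \<phi> x0 \<mu> + ?\<epsilon> i) * real n \<le> (drift G \<phi> x0 \<mu> + \<epsilon>) * real n"
          using i by (intro mult_right_mono) auto
        finally show ?case by (simp add: z0 displacement_def dist_commute) (simp add: z_def)
      qed
    qed
    then show ?case by (simp add: z0) (simp add: z_def)
  qed
qed

theorem mainTheorem3:
  fixes G :: "('g, 'm) monoid_scheme"
    and \<mu> :: "'g measure"
    and \<phi> :: "'g \<Rightarrow> 'x \<Rightarrow> 'x::complete_space"
    and x0 :: 'x
  assumes "group G" and "countable (carrier G)"
    and "discrete_prob_on G \<mu>" and "admissible G \<mu>"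
    and "finite_first_moment \<phi> x0 \<mu>"
    and "separable_space (euclidean :: 'x topology)" and "CAT0 TYPE('x)"
    and "group_action G UNIV \<phi>"
    and "\<forall>g\<in>carrier G. \<forall>x y. dist (\<phi> g x) (\<phi> g y) = dist x y"
    and "\<exists>g\<in>carrier G. \<exists>h\<in>carrier G.
           contracting_isometry (\<phi> g) \<and> contracting_isometry (\<phi> h) \<and>
           independent_elements G \<phi> x0 g h"
  shows "mean_speed G \<phi> x0 \<mu> \<longlonglongrightarrow> drift G \<phi> x0 \<mu> \<and>
         0 < drift G \<phi> x0 \<mu> \<and>
         (AE \<omega> in increments \<mu>. \<exists>\<gamma>. geodesic_on {0..} \<gamma> \<and> \<gamma> 0 = x0 \<and>
            (\<lambda>n. (1 / real n) * dist (\<gamma> (drift G \<phi> x0 \<mu> * real n)) (\<phi> (walk G \<omega> n) x0))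
              \<longlonglongrightarrow> 0)"
proof -
  interpret isometric_random_walk G \<mu> \<phi> x0
    using assms by (simp add: isometric_random_walk_def isometric_random_walk_axioms_def)
  obtain g h where gh: "g \<in> carrier G" "h \<in> carrier G" "contracting_isometry (\<phi> g)"
    "contracting_isometry (\<phi> h)" "independent_elements G \<phi> x0 g h"
    using assms by blast
  obtain N0 where "\<forall>N\<ge>N0. \<forall>x y. 4 * dist x0 y + 1 \<le>
      dist (\<phi> (g [^]\<^bsub>G\<^esub> (N::nat)) x) y + dist (\<phi> (inv\<^bsub>G\<^esub> (g [^]\<^bsub>G\<^esub> N)) x) y +
      dist (\<phi> (h [^]\<^bsub>G\<^esub> N) x) y + dist (\<phi> (inv\<^bsub>G\<^esub> (h [^]\<^bsub>G\<^esub> N)) x) y"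
    using independent_contracting_spread[OF \<open>CAT0 TYPE('x)\<close> gh] by blast
  then have "0 < drift G \<phi> x0 \<mu>"
    using drift_pos[OF \<open>admissible G \<mu>\<close> gh(1,2), of N0] by blast
  then show ?thesis
    using mean_speed_limit(1) AE_ray_tracking[OF isometric_random_walk_axioms \<open>CAT0 TYPE('x)\<close>]
    by blast
qed

end
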